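(* Let $G$ be a fully left-orderable group with presentation $\langle X\mid R\rangle$. (a) For any elements $[t_1],\dots,[t_n]$ in $G$ ($n\ge1$) corresponding to elements $t_1,\dots,t_n$ of the free group over $X$, $$e_G\in\{[t_1],\dots,[t_n]\}^+\iff\{r\approx e: r\in R\}\models_{\mathsf{LG}} e\le t_1\vee\dots\vee t_n.$$ (b) The Identity Problem for $G$ is decidable if and only if the Word Problem for the $\ell$-group with presentation $\langle X\mid R\rangle$ is decidable.
   Context: A partial left-order on $G$ is a partial order $\le$ with $a\le b\Rightarrow ca\le cb$ for all $a,b,c\in G$; it is a left-order if total. $G$ is fully left-orderable if every partial left-order on $G$ extends to a left-order on $G$ (i.e. its positive cone $\{a\mid e_G<a\}$ is contained in that of a left-order). For $S\subseteq G$, $S^+$ is the subsemigroup generated by $S$. The Identity Problem for $G$ asks, for a given finite set $S$ of elements of $G$ (given as words over $X\cup X^{-1}$), whether $e_G\in S^+$. An $\ell$-group is a structure $\langle L,\wedge,\vee,\cdot,{}^{-1},e\rangle$ such that $\langle L,\cdot,{}^{-1},e\rangle$ is a group, $\langle L,\wedge,\vee\rangle$ is a lattice with order $a\le b:\Leftrightarrow a\wedge b=a$, and $a\le b$ implies $cad\le cbd$ for all $a,b,c,d\in L$. $\mathsf{LG}$ is the variety of $\ell$-groups. For a set $\Sigma\cup\{s\approx t\}$ of $\ell$-group equations, $\Sigma\models_{\mathsf{LG}}s\approx t$ means: for any homomorphism $h$ from the algebra of $\ell$-group terms to some $L\in\mathsf{LG}$, if $h(s')=h(t')$ for all $s'\approx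 t'\in\Sigma$, then $h(s)=h(t)$; an inequation $s\le t$ stands for $s\wedge t\approx s$. The $\ell$-group with presentation $\langle X\mid R\rangle$ is the quotient of the free $\ell$-group over $X$ by the congruence generated by the relations $r\approx e$ ($r\in R$); its Word Problem is to decide, given $\ell$-group terms $s,t$ over $X$, whether $\{r\approx e\mid r\in R\}\models_{\mathsf{LG}}s\approx t$. *)

theory Defs
  imports "HOL-Algebra.Coset" "HOL-Library.Nat_Bijection"
begin

section \<open>Free groups and group presentations\<close>

text \<open>The letter \<open>(x, True)\<close> stands for the generator \<open>x\<close> and \<open>(x, False)\<close> for its inverse.\<close>

type_synonym 'x word = "('x \<times> bool) list"

abbreviation words :: "'x set \<Rightarrow> 'x word set" where
  "words X \<equiv> lists (X \<times> UNIV)"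

fun letter_inv :: "'x \<times> bool \<Rightarrow> 'x \<times> bool" where
  "letter_inv (x, b) = (x, \<not> b)"

definition reduced :: "'x word \<Rightarrow> bool" where
  "reduced w \<longleftrightarrow> successively (\<lambda>a b. b \<noteq> letter_inv a) w"

fun cancel_Cons :: "'x \<times> bool \<Rightarrow> 'x word \<Rightarrow> 'x word" where
  "cancel_Cons a [] = [a]"
| "cancel_Cons a (b # w) = (if b = letter_inv a then w else a # b # w)"

definition reduce :: "'x word \<Rightarrow> 'x word" where
  "reduce w = foldr cancel_Cons w []"

definition free_group :: "'x set \<Rightarrow> 'x word monoid" where
  "free_group X = \<lparr>carrier = {w \<in> words X. reduced w}, mult = (\<lambda>u v. reduce (u @ v)), one = []\<rparr>"

definition normal_closure :: "('g, 'm) monoid_scheme \<Rightarrow> 'g set \<Rightarrow> 'g set" where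
  "normal_closure G R = \<Inter> {N. N \<lhd> G \<and> R \<subseteq> N}"

definition presented_group :: "'x set \<Rightarrow> 'x word set \<Rightarrow> 'x word set monoid" where
  "presented_group X R = free_group X Mod normal_closure (free_group X) R"

text \<open>The element of the presented group named by a word, which need not be reduced.\<close>

definition word_class :: "'x set \<Rightarrow> 'x word set \<Rightarrow> 'x word \<Rightarrow> 'x word set" where
  "word_class X R w = normal_closure (free_group X) R #>\<^bsub>free_group X\<^esub> reduce w"

lemma letter_inv_letter_inv [simp]: "letter_inv (letter_inv a) = a"
  by (cases a) simp

lemma reduced_Nil [simp]: "reduced []"
  by (simp add: reduced_def)

lemma reduced_Cons: "reduced (a # w) \<longleftrightarrow> (w = [] \<or> hd w \<noteq> letter_inv a) \<and> reduced w"
  by (auto simp: reduced_def successively_Cons)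

lemma reduced_cancel_Cons: "reduced w \<Longrightarrow> reduced (cancel_Cons a w)"
  by (cases w) (auto simp: reduced_Cons)

lemma cancel_Cons_inverse: "reduced w \<Longrightarrow> cancel_Cons a (cancel_Cons (letter_inv a) w) = w"
proof (cases w)
  case (Cons b v)
  assume "reduced w"
  then show ?thesis using Cons by (cases v) (auto simp: reduced_Cons)
qed simp

lemma reduced_foldr_cancel_Cons: "reduced w \<Longrightarrow> reduced (foldr cancel_Cons u w)"
  by (induction u) (auto simp: reduced_cancel_Cons)

lemma reduced_reduce [simp]: "reduced (reduce w)"
  by (simp add: reduce_def reduced_foldr_cancel_Cons)

lemma reduce_reduced [simp]: "reduced w \<Longrightarrow> reduce w = w"
proof (induction w)
  case (Cons a w)
  then have "reduce (a # w) = cancel_Cons a w" by (auto simp: reduce_def reduced_Cons)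
  then show ?case using Cons.prems by (cases w) (auto simp: reduced_Cons)
qed (simp add: reduce_def)

lemma cancel_Cons_in_words: "\<lbrakk>a \<in> X \<times> UNIV; w \<in> words X\<rbrakk> \<Longrightarrow> cancel_Cons a w \<in> words X"
  by (cases w) auto

lemma reduce_in_words: "w \<in> words X \<Longrightarrow> reduce w \<in> words X"
proof (induction w)
  case (Cons a w)
  then show ?case using cancel_Cons_in_words[of a X "reduce w"] by (simp add: reduce_def)
qed (simp add: reduce_def)

lemma foldr_cancel_Cons:
  assumes "reduced w"
  shows "foldr cancel_Cons (cancel_Cons a v) w = cancel_Cons a (foldr cancel_Cons v w)"
proof (cases v)
  case (Cons b v')
  have "reduced (foldr cancel_Cons v' w)" by (simp add: assms reduced_foldr_cancel_Cons)
  then show ?thesis using Cons by (auto simp: cancel_Cons_inverse)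
qed simp

lemma foldr_cancel_Cons_reduce:
  "reduced w \<Longrightarrow> foldr cancel_Cons (reduce u) w = foldr cancel_Cons u w"
  by (induction u) (auto simp: reduce_def foldr_cancel_Cons)

lemma reduce_append_left [simp]: "reduce (reduce u @ v) = reduce (u @ v)"
  using foldr_cancel_Cons_reduce[of "reduce v" u] by (simp add: reduce_def)
    (metis reduce_def reduced_reduce foldr_cancel_Cons_reduce)

lemma reduce_append_right [simp]: "reduce (u @ reduce v) = reduce (u @ v)"
  by (metis foldr_append reduce_def reduce_reduced reduced_reduce)

lemma reduce_inverse_word: "reduce (map letter_inv (rev u) @ u) = []"
proof (induction u)
  case (Cons a u)
  have "reduce (map letter_inv (rev (a # u)) @ a # u)
      = foldr cancel_Cons (map letter_inv (rev u)) (cancel_Cons (letter_inv a) (cancel_Cons a (reduce u)))"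
    by (simp add: reduce_def)
  also have "\<dots> = reduce (map letter_inv (rev u) @ u)"
    using cancel_Cons_inverse[OF reduced_reduce, of "letter_inv a" u] by (simp add: reduce_def)
  finally show ?case using Cons by simp
qed (simp add: reduce_def)

lemma inverse_word_in_words: "u \<in> words X \<Longrightarrow> map letter_inv (rev u) \<in> words X"
  by (auto simp: in_lists_conv_set)

theorem group_free_group: "group (free_group X)"
proof (rule groupI)
  fix u assume u: "u \<in> carrier (free_group X)"
  show "\<exists>v\<in>carrier (free_group X). v \<otimes>\<^bsub>free_group X\<^esub> u = \<one>\<^bsub>free_group X\<^esub>"
  proof
    show "reduce (map letter_inv (rev u)) \<in> carrier (free_group X)"
      using u reduce_in_words[OF inverse_word_in_words, of u X] by (simp add: free_group_def)
    show "reduce (map letter_inv (rev u)) \<otimes>\<^bsub>free_group X\<^esub> u = \<one>\<^bsub>free_group X\<^esub>"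
      by (simp add: free_group_def reduce_inverse_word)
  qed
next
  fix u v assume "u \<in> carrier (free_group X)" and "v \<in> carrier (free_group X)"
  then show "u \<otimes>\<^bsub>free_group X\<^esub> v \<in> carrier (free_group X)"
    using reduce_in_words[of "u @ v" X] by (simp add: free_group_def)
qed (simp_all add: free_group_def)

theorem normal_normal_closure:
  assumes "group G" and "R \<subseteq> carrier G"
  shows "normal_closure G R \<lhd> G"
proof -
  interpret group G by fact
  have top: "carrier G \<lhd> G" by (rule group.normal_invI) (auto simp: subgroup_self is_group)
  have "subgroup (normal_closure G R) G"
    unfolding normal_closure_def
    by (rule subgroups_Inter) (use top assms(2) in \<open>auto simp: normal_def\<close>)
  then show ?thesis
    by (auto simp: normal_inv_iff normal_closure_def)
qed

theorem group_presented_group: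
  "R \<subseteq> carrier (free_group X) \<Longrightarrow> group (presented_group X R)"
  unfolding presented_group_def
  by (intro normal.factorgroup_is_group normal_normal_closure group_free_group)


section \<open>Left-orders and subsemigroups\<close>

definition partial_left_order :: "('g, 'm) monoid_scheme \<Rightarrow> ('g \<times> 'g) set \<Rightarrow> bool" where
  "partial_left_order G r \<longleftrightarrow> partial_order_on (carrier G) r \<and>
    (\<forall>a\<in>carrier G. \<forall>b\<in>carrier G. \<forall>c\<in>carrier G.
       (a, b) \<in> r \<longrightarrow> (c \<otimes>\<^bsub>G\<^esub> a, c \<otimes>\<^bsub>G\<^esub> b) \<in> r)"

definition left_order :: "('g, 'm) monoid_scheme \<Rightarrow> ('g \<times> 'g) set \<Rightarrow> bool" where
  "left_order G r \<longleftrightarrow> partial_left_order G r \<and> total_on (carrier G) r"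

definition fully_left_orderable :: "('g, 'm) monoid_scheme \<Rightarrow> bool" where
  "fully_left_orderable G \<longleftrightarrow>
    (\<forall>r. partial_left_order G r \<longrightarrow> (\<exists>r'. left_order G r' \<and> r \<subseteq> r'))"

inductive_set subsemigroup_gen :: "('g, 'm) monoid_scheme \<Rightarrow> 'g set \<Rightarrow> 'g set"
  for G and S where
  base: "a \<in> S \<Longrightarrow> a \<in> subsemigroup_gen G S"
| mult: "\<lbrakk>a \<in> subsemigroup_gen G S; b \<in> subsemigroup_gen G S\<rbrakk>
    \<Longrightarrow> a \<otimes>\<^bsub>G\<^esub> b \<in> subsemigroup_gen G S"


section \<open>Lattice-ordered groups\<close>

record 'a lgroup = "'a monoid" +
  lmeet :: "'a \<Rightarrow> 'a \<Rightarrow> 'a"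
  ljoin :: "'a \<Rightarrow> 'a \<Rightarrow> 'a"

locale lgroup = group L for L :: "('a, 'm) lgroup_scheme" (structure) +
  assumes lmeet_closed: "\<lbrakk>a \<in> carrier L; b \<in> carrier L\<rbrakk> \<Longrightarrow> lmeet L a b \<in> carrier L"
    and ljoin_closed: "\<lbrakk>a \<in> carrier L; b \<in> carrier L\<rbrakk> \<Longrightarrow> ljoin L a b \<in> carrier L"
    and lmeet_commute: "\<lbrakk>a \<in> carrier L; b \<in> carrier L\<rbrakk> \<Longrightarrow> lmeet L a b = lmeet L b a"
    and ljoin_commute: "\<lbrakk>a \<in> carrier L; b \<in> carrier L\<rbrakk> \<Longrightarrow> ljoin L a b = ljoin L b a"
    and lmeet_assoc: "\<lbrakk>a \<in> carrier L; b \<in> carrier L; c \<in> carrier L\<rbrakk>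
      \<Longrightarrow> lmeet L (lmeet L a b) c = lmeet L a (lmeet L b c)"
    and ljoin_assoc: "\<lbrakk>a \<in> carrier L; b \<in> carrier L; c \<in> carrier L\<rbrakk>
      \<Longrightarrow> ljoin L (ljoin L a b) c = ljoin L a (ljoin L b c)"
    and lmeet_absorb: "\<lbrakk>a \<in> carrier L; b \<in> carrier L\<rbrakk> \<Longrightarrow> lmeet L a (ljoin L a b) = a"
    and ljoin_absorb: "\<lbrakk>a \<in> carrier L; b \<in> carrier L\<rbrakk> \<Longrightarrow> ljoin L a (lmeet L a b) = a"
    and mult_mono: "\<lbrakk>a \<in> carrier L; b \<in> carrier L; c \<in> carrier L; d \<in> carrier L; lmeet L a b = a\<rbrakk>
      \<Longrightarrow> lmeet L (c \<otimes> a \<otimes> d) (c \<otimes> b \<otimes> d) = c \<otimes> a \<otimes> d"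

datatype 'x lterm =
    Var 'x
  | One
  | Inv "'x lterm"
  | Mul "'x lterm" "'x lterm"
  | Meet "'x lterm" "'x lterm"
  | Join "'x lterm" "'x lterm"

definition lterms :: "'x set \<Rightarrow> 'x lterm set" where
  "lterms X = {t. set_lterm t \<subseteq> X}"

text \<open>Homomorphisms from the algebra of all terms to an \<open>\<ell>\<close>-group.\<close>

definition lterm_hom :: "('a, 'm) lgroup_scheme \<Rightarrow> ('x lterm \<Rightarrow> 'a) set" where
  "lterm_hom L = {h. range h \<subseteq> carrier L \<and>
     h One = \<one>\<^bsub>L\<^esub> \<and>
     (\<forall>s. h (Inv s) = inv\<^bsub>L\<^esub> (h s)) \<and>
     (\<forall>s t. h (Mul s t) = h s \<otimes>\<^bsub>L\<^esub> h t) \<and>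
     (\<forall>s t. h (Meet s t) = lmeet L (h s) (h t)) \<and>
     (\<forall>s t. h (Join s t) = ljoin L (h s) (h t))}"

text \<open>
  A pair of terms is read as an equation. Since HOL cannot quantify over all types inside a formula,
  \<open>\<ell>\<close>-groups are drawn here from one type that contains every quotient of the term algebra. By
  \<open>lg_consequence_universal\<close> below, consequence in this sense implies consequence in
  \<open>\<ell>\<close>-groups over any other type, so the choice of type is immaterial.
\<close>

definition lg_consequence ::
  "('x lterm \<times> 'x lterm) set \<Rightarrow> 'x lterm \<times> 'x lterm \<Rightarrow> bool" (infix \<open>\<Turnstile>LG\<close> 50) where
  "\<Sigma> \<Turnstile>LG E \<longleftrightarrow>
    (\<forall>(L :: 'x lterm set lgroup) h. lgroup L \<longrightarrow> h \<in> lterm_hom L \<longrightarrow>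
       (\<forall>(s, t)\<in>\<Sigma>. h s = h t) \<longrightarrow> h (fst E) = h (snd E))"

definition leq_eqn :: "'x lterm \<Rightarrow> 'x lterm \<Rightarrow> 'x lterm \<times> 'x lterm" where
  "leq_eqn s t = (Meet s t, s)"

theorem lg_consequence_universal:
  fixes L :: "('a, 'm) lgroup_scheme" and h :: "'x lterm \<Rightarrow> 'a"
  assumes cons: "\<Sigma> \<Turnstile>LG (s, t)"
    and L: "lgroup L"
    and h: "h \<in> lterm_hom L"
    and \<Sigma>: "\<forall>(s', t')\<in>\<Sigma>. h s' = h t'"
  shows "h s = h t"
proof -
  interpret lgroup L by fact
  have hc [simp]: "h u \<in> carrier L" for u using h by (auto simp: lterm_hom_def)
  have hs: "h One = \<one>\<^bsub>L\<^esub>" "h (Inv u) = inv\<^bsub>L\<^esub> (h u)" "h (Mul u v) = h u \<otimes>\<^bsub>L\<^esub> h v"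
    "h (Meet u v) = lmeet L (h u) (h v)" "h (Join u v) = ljoin L (h u) (h v)" for u v
    using h by (auto simp: lterm_hom_def)
  define k where "k u = {v. h v = h u}" for u
  have k_eq: "k u = k v \<longleftrightarrow> h u = h v" for u v
    by (auto simp: k_def)
  define rep where "rep A = (SOME u. k u = A)" for A
  have h_rep [simp]: "h (rep (k u)) = h u" for u
    unfolding rep_def k_eq[symmetric] by (rule someI[of "\<lambda>v. k v = k u"]) simp
  define Q where "Q = \<lparr>carrier = range k, mult = (\<lambda>A B. k (Mul (rep A) (rep B))), one = k One,
    lmeet = (\<lambda>A B. k (Meet (rep A) (rep B))), ljoin = (\<lambda>A B. k (Join (rep A) (rep B)))\<rparr>"
  have Qs: "carrier Q = range k" "\<one>\<^bsub>Q\<^esub> = k One" "k u \<otimes>\<^bsub>Q\<^esub> k v = k (Mul u v)"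
    "lmeet Q (k u) (k v) = k (Meet u v)" "ljoin Q (k u) (k v) = k (Join u v)" for u v
    by (simp_all add: Q_def k_eq hs)
  have Q_cases: thesis if "A \<in> carrier Q" and "\<And>u. A = k u \<Longrightarrow> thesis" for A thesis
    using that by (auto simp: Qs)
  have gQ: "group Q"
  proof (rule groupI)
    fix A assume "A \<in> carrier Q"
    then obtain u where "A = k u" by (auto simp: Qs)
    then show "\<exists>B\<in>carrier Q. B \<otimes>\<^bsub>Q\<^esub> A = \<one>\<^bsub>Q\<^esub>"
      by (intro bexI[of _ "k (Inv u)"]) (auto simp: Qs k_eq hs)
  qed ((elim Q_cases)?, simp add: Qs k_eq hs rangeI m_assoc)+
  have lQ: "lgroup Q"
    by (intro lgroup.intro gQ lgroup_axioms.intro)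
      ((elim Q_cases)?, simp add: Qs k_eq hs rangeI lmeet_commute ljoin_commute lmeet_assoc ljoin_assoc
        lmeet_absorb ljoin_absorb mult_mono)+
  have "inv\<^bsub>Q\<^esub> (k u) = k (Inv u)" for u
    by (rule group.inv_equality[OF gQ]) (auto simp: Qs k_eq hs)
  then have kQ: "k \<in> lterm_hom Q"
    by (auto simp: lterm_hom_def Qs)
  have "\<forall>(s', t')\<in>\<Sigma>. k s' = k t'" using \<Sigma> by (simp add: k_eq)
  then have "k s = k t" using cons lQ kQ unfolding lg_consequence_def by auto
  then show ?thesis by (simp add: k_eq)
qed

fun letter_term :: "'x \<times> bool \<Rightarrow> 'x lterm" where
  "letter_term (x, b) = (if b then Var x else Inv (Var x))"

fun word_term :: "'x word \<Rightarrow> 'x lterm" where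
  "word_term [] = One"
| "word_term (a # w) = Mul (letter_term a) (word_term w)"

fun big_join :: "'x lterm list \<Rightarrow> 'x lterm" where
  "big_join [t] = t"
| "big_join (t # u # ts) = Join t (big_join (u # ts))"

definition relator_eqns :: "'x word set \<Rightarrow> ('x lterm \<times> 'x lterm) set" where
  "relator_eqns R = {(word_term r, One) | r. r \<in> R}"


section \<open>Decidability\<close>

text \<open>
  The total recursive functions of each arity: the least class that contains the initial functions and
  is closed under composition, primitive recursion and minimization of regular functions. An
  \<open>n\<close>-ary function is represented on lists, of which only those of length \<open>n\<close> matter.
\<close>

inductive recursive_fn :: "nat \<Rightarrow> (nat list \<Rightarrow> nat) \<Rightarrow> bool" where
  zero: "recursive_fn n (\<lambda>_. 0)"
| succ: "recursive_fn 1 (\<lambda>xs. Suc (xs ! 0))"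
| proj: "i < n \<Longrightarrow> recursive_fn n (\<lambda>xs. xs ! i)"
| comp: "\<lbrakk>recursive_fn (length gs) f; \<forall>g\<in>set gs. recursive_fn n g\<rbrakk>
    \<Longrightarrow> recursive_fn n (\<lambda>xs. f (map (\<lambda>g. g xs) gs))"
| prim_rec: "\<lbrakk>recursive_fn n f; recursive_fn (n + 2) g\<rbrakk>
    \<Longrightarrow> recursive_fn (n + 1) (\<lambda>xs. rec_nat (f (tl xs)) (\<lambda>y r. g (y # r # tl xs)) (hd xs))"
| minimize: "\<lbrakk>recursive_fn (n + 1) f; \<And>xs. length xs = n \<Longrightarrow> \<exists>y. f (y # xs) = 0\<rbrakk>
    \<Longrightarrow> recursive_fn n (\<lambda>xs. LEAST y. f (y # xs) = 0)"

text \<open>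
  The decision problem with set of instances \<open>I\<close>, encoded by \<open>code\<close>, and question \<open>P\<close>. As usual, the
  algorithm is only required to be correct on codes of instances.
\<close>

definition decidable_problem :: "('i \<Rightarrow> nat) \<Rightarrow> 'i set \<Rightarrow> ('i \<Rightarrow> bool) \<Rightarrow> bool" where
  "decidable_problem code I P \<longleftrightarrow>
    (\<exists>f. recursive_fn 1 f \<and> (\<forall>i\<in>I. f [code i] = (if P i then 1 else 0)))"

text \<open>Codes of words and terms, given a numbering \<open>\<nu>\<close> of the generators.\<close>

definition word_code :: "('x \<Rightarrow> nat) \<Rightarrow> 'x word \<Rightarrow> nat" where
  "word_code \<nu> w = list_encode (map (\<lambda>(x, b). prod_encode (\<nu> x, of_bool b)) w)"

primrec lterm_code :: "('x \<Rightarrow> nat) \<Rightarrow> 'x lterm \<Rightarrow> nat" where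
  "lterm_code \<nu> (Var x) = prod_encode (0, \<nu> x)"
| "lterm_code \<nu> One = prod_encode (1, 0)"
| "lterm_code \<nu> (Inv s) = prod_encode (2, lterm_code \<nu> s)"
| "lterm_code \<nu> (Mul s t) = prod_encode (3, prod_encode (lterm_code \<nu> s, lterm_code \<nu> t))"
| "lterm_code \<nu> (Meet s t) = prod_encode (4, prod_encode (lterm_code \<nu> s, lterm_code \<nu> t))"
| "lterm_code \<nu> (Join s t) = prod_encode (5, prod_encode (lterm_code \<nu> s, lterm_code \<nu> t))"

text \<open>A finite set of group elements is given by a list of words.\<close>

definition identity_problem_decidable :: "('x \<Rightarrow> nat) \<Rightarrow> 'x set \<Rightarrow> 'x word set \<Rightarrow> bool" where
  "identity_problem_decidable \<nu> X R \<longleftrightarrow>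
    decidable_problem (\<lambda>ws. list_encode (map (word_code \<nu>) ws)) (lists (words X))
      (\<lambda>ws. \<one>\<^bsub>presented_group X R\<^esub> \<in>
        subsemigroup_gen (presented_group X R) (word_class X R ` set ws))"

definition lgroup_word_problem_decidable :: "('x \<Rightarrow> nat) \<Rightarrow> 'x set \<Rightarrow> 'x word set \<Rightarrow> bool" where
  "lgroup_word_problem_decidable \<nu> X R \<longleftrightarrow>
    decidable_problem (\<lambda>(s, t). prod_encode (lterm_code \<nu> s, lterm_code \<nu> t)) (lterms X \<times> lterms X)
      (\<lambda>(s, t). relator_eqns R \<Turnstile>LG (s, t))"

end

theory Submission
  imports Defs
begin

text \<open>
  If \<open>e\<close> is a product of \<open>n\<close> of the \<open>t\<^sub>i\<close>, then \<open>e \<le> (t\<^sub>1 \<squnion> \<dots> \<squnion> t\<^sub>k)\<^sup>n\<close> in every \<open>\<ell>\<close>-group that satisfies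
  the relations, and \<open>e \<le> a\<^sup>n\<close> implies \<open>e \<le> a\<close> in \<open>\<ell>\<close>-groups. Conversely, if \<open>e\<close> is not in the
  subsemigroup generated by the \<open>t\<^sub>i\<close>, then that subsemigroup is the negative cone of a partial left-order,
  which extends to a left-order; in the \<open>\<ell>\<close>-group of automorphisms of the resulting chain, all the left
  translations by the \<open>t\<^sub>i\<close>, and hence their join, move \<open>e\<close> strictly down.

  For decidability, \<open>s \<approx> t\<close> is equivalent to \<open>e \<le> s\<inverse>t \<sqinter> t\<inverse>s\<close>. Distributivity splits such an inequality into
  finitely many inequalities \<open>e \<le> w\<^sub>1 \<squnion> \<dots> \<squnion> w\<^sub>k\<close> between words, which are instances of the Identity Problem.
  The splitting is done by a rewriting machine whose step function needs only pairing and case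
  distinctions on codes, and whose running time is at most \<open>3 ^ 3 ^ (c + 1)\<close> for a term with code \<open>c\<close>.
\<close>

subsection \<open>Lattice-ordered groups\<close>

context lgroup begin

abbreviation le :: "'a \<Rightarrow> 'a \<Rightarrow> bool" where "le a b \<equiv> lmeet L a b = a"

lemma le_iff_ljoin:
  "a \<in> carrier L \<Longrightarrow> b \<in> carrier L \<Longrightarrow> le a b \<longleftrightarrow> ljoin L a b = b"
  by (metis lmeet_absorb ljoin_absorb lmeet_commute ljoin_commute)

lemma le_refl: "a \<in> carrier L \<Longrightarrow> le a a"
  by (metis lmeet_absorb ljoin_absorb lmeet_closed)

lemma le_trans: "\<lbrakk>le a b; le b c; a \<in> carrier L; b \<in> carrier L; c \<in> carrier L\<rbrakk> \<Longrightarrow> le a c"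
  by (metis lmeet_assoc)

lemma le_antisym: "\<lbrakk>le a b; le b a; a \<in> carrier L; b \<in> carrier L\<rbrakk> \<Longrightarrow> a = b"
  by (metis lmeet_commute)

lemma le_lmeet_iff:
  assumes "a \<in> carrier L" "b \<in> carrier L" "c \<in> carrier L"
  shows "le c (lmeet L a b) \<longleftrightarrow> le c a \<and> le c b"
proof -
  have "le (lmeet L a b) a" "le (lmeet L a b) b"
    using assms by (metis lmeet_assoc lmeet_commute lmeet_closed le_refl)+
  then show ?thesis using assms by (metis le_trans lmeet_assoc lmeet_closed)
qed

lemma ljoin_le_iff:
  assumes "a \<in> carrier L" "b \<in> carrier L" "c \<in> carrier L"
  shows "le (ljoin L a b) c \<longleftrightarrow> le a c \<and> le b c"
proof -
  have "le a (ljoin L a b)" "le b (ljoin L a b)"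
    using assms by (metis lmeet_absorb ljoin_commute)+
  moreover have "le (ljoin L a b) c" if "le a c" "le b c"
    using that assms by (simp add: le_iff_ljoin ljoin_closed ljoin_assoc)
  ultimately show ?thesis using assms by (meson le_trans ljoin_closed)
qed

lemma le_mult_left: "\<lbrakk>le a b; a \<in> carrier L; b \<in> carrier L; c \<in> carrier L\<rbrakk> \<Longrightarrow> le (c \<otimes> a) (c \<otimes> b)"
  using mult_mono[of a b c \<one>] by simp

lemma le_mult_right: "\<lbrakk>le a b; a \<in> carrier L; b \<in> carrier L; c \<in> carrier L\<rbrakk> \<Longrightarrow> le (a \<otimes> c) (b \<otimes> c)"
  using mult_mono[of a b \<one> c] by simp

lemma le_mult:
  assumes "le a b" "le c d" "a \<in> carrier L" "b \<in> carrier L" "c \<in> carrier L" "d \<in> carrier L"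
  shows "le (a \<otimes> c) (b \<otimes> d)"
  using le_trans[OF le_mult_right[OF assms(1,3,4,5)] le_mult_left[OF assms(2,5,6,4)]] assms by simp

lemma le_mult_left_iff:
  assumes "a \<in> carrier L" "b \<in> carrier L" "c \<in> carrier L"
  shows "le a (c \<otimes> b) \<longleftrightarrow> le (inv c \<otimes> a) b"
  using le_mult_left[of a "c \<otimes> b" "inv c"] le_mult_left[of "inv c \<otimes> a" b c] assms
  by (auto simp: m_assoc[symmetric])

lemma le_mult_right_iff:
  assumes "a \<in> carrier L" "b \<in> carrier L" "c \<in> carrier L"
  shows "le a (b \<otimes> c) \<longleftrightarrow> le (a \<otimes> inv c) b"
  using le_mult_right[of a "b \<otimes> c" "inv c"] le_mult_right[of "a \<otimes> inv c" b c] assms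
  by (auto simp: m_assoc)

lemma mult_le_left_iff:
  assumes "a \<in> carrier L" "b \<in> carrier L" "c \<in> carrier L"
  shows "le (c \<otimes> a) b \<longleftrightarrow> le a (inv c \<otimes> b)"
  using le_mult_left_iff[of a b "inv c"] assms by simp

lemma mult_le_right_iff:
  assumes "a \<in> carrier L" "b \<in> carrier L" "c \<in> carrier L"
  shows "le (a \<otimes> c) b \<longleftrightarrow> le a (b \<otimes> inv c)"
  using le_mult_right_iff[of a b "inv c"] assms by simp

text \<open>Antisymmetry in terms of upper bounds: expressions with joins can be compared by moving
  factors across the order with the equivalences above.\<close>

lemma le_cong_iff:
  assumes "a \<in> carrier L" "b \<in> carrier L" "\<And>z. z \<in> carrier L \<Longrightarrow> le a z \<longleftrightarrow> le b z"
  shows "a = b"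
  using assms by (metis le_antisym le_refl)

lemma ge_cong_iff:
  assumes "a \<in> carrier L" "b \<in> carrier L" "\<And>z. z \<in> carrier L \<Longrightarrow> le z a \<longleftrightarrow> le z b"
  shows "a = b"
  using assms by (metis le_antisym le_refl)

text \<open>Multiplying by \<open>c\<close> and \<open>d\<close> is an order automorphism and so
  preserves joins; the proof moves both factors over to the test element.\<close>

lemma mult_ljoin_distrib:
  assumes "a \<in> carrier L" "b \<in> carrier L" "c \<in> carrier L" "d \<in> carrier L"
  shows "c \<otimes> ljoin L a b \<otimes> d = ljoin L (c \<otimes> a \<otimes> d) (c \<otimes> b \<otimes> d)"
  using assms
  by (intro le_cong_iff) (simp_all add: ljoin_closed mult_le_right_iff[of _ _ d]
      mult_le_left_iff[of _ _ c] ljoin_le_iff)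

lemma mult_lmeet_distrib:
  assumes "a \<in> carrier L" "b \<in> carrier L" "c \<in> carrier L" "d \<in> carrier L"
  shows "c \<otimes> lmeet L a b \<otimes> d = lmeet L (c \<otimes> a \<otimes> d) (c \<otimes> b \<otimes> d)"
  using assms
  by (intro ge_cong_iff) (simp_all add: lmeet_closed le_mult_right_iff[of _ _ d]
      le_mult_left_iff[of _ _ c] le_lmeet_iff)

lemma le_inv_iff:
  assumes "a \<in> carrier L" "b \<in> carrier L"
  shows "le a (inv b) \<longleftrightarrow> le b (inv a)"
  using le_mult_right_iff[of a \<one> "inv b"] mult_le_left_iff[of b \<one> a] assms by simp

lemma inv_le_iff:
  assumes "a \<in> carrier L" "b \<in> carrier L"
  shows "le (inv a) b \<longleftrightarrow> le (inv b) a"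
  using mult_le_left_iff[of \<one> b "inv a"] le_mult_right_iff[of \<one> a b] assms by simp

text \<open>Inversion reverses the order, so it exchanges upper and lower bounds.\<close>

lemma inv_ljoin:
  assumes "a \<in> carrier L" "b \<in> carrier L"
  shows "inv (ljoin L a b) = lmeet L (inv a) (inv b)"
  using assms
  by (intro ge_cong_iff) (simp_all add: ljoin_closed lmeet_closed le_lmeet_iff ljoin_le_iff
      le_inv_iff[of _ "ljoin L a b"] le_inv_iff[of _ a] le_inv_iff[of _ b])

lemma inv_lmeet:
  assumes "a \<in> carrier L" "b \<in> carrier L"
  shows "inv (lmeet L a b) = ljoin L (inv a) (inv b)"
  using assms
  by (intro le_cong_iff) (simp_all add: ljoin_closed lmeet_closed le_lmeet_iff ljoin_le_iff
      inv_le_iff[of "lmeet L a b"] inv_le_iff[of a] inv_le_iff[of b])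

text \<open>The lattice is distributive: with \<open>m = a \<sqinter> b\<close>, both \<open>z \<squnion> a\<close> and \<open>z \<squnion> b\<close> lie below translates
  \<open>(z \<squnion> m) m\<inverse> a\<close> and \<open>(z \<squnion> m) m\<inverse> b\<close>, and the meet of these is \<open>z \<squnion> m\<close>.\<close>

lemma lmeet_ljoin_le:
  assumes c: "a \<in> carrier L" "b \<in> carrier L" "z \<in> carrier L" and le: "le (lmeet L a b) z"
  shows "lmeet L (ljoin L z a) (ljoin L z b) = z"
proof -
  define m where "m = lmeet L a b"
  have m: "m \<in> carrier L" "le m a" "le m b"
    using c le_lmeet_iff[of a b m] le_refl[of m] by (simp_all add: m_def lmeet_closed)
  have step: "le (ljoin L z x) (z \<otimes> inv m \<otimes> x)" if x: "x \<in> carrier L" "le m x" for x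
  proof -
    have "le \<one> (inv m \<otimes> x)" using x m c mult_le_left_iff[of \<one> x m] by simp
    then have "le z (z \<otimes> (inv m \<otimes> x))" using le_mult_left[of \<one> "inv m \<otimes> x" z] x m c by simp
    moreover have "le x (z \<otimes> inv m \<otimes> x)"
    proof -
      have "le \<one> (z \<otimes> inv m)" using mult_le_right_iff[of \<one> z m] le m c by (simp add: m_def)
      then show ?thesis using le_mult_right[of \<one> "z \<otimes> inv m" x] x m c by simp
    qed
    ultimately show ?thesis using x m c by (simp add: ljoin_le_iff m_assoc)
  qed
  let ?l = "lmeet L (ljoin L z a) (ljoin L z b)"
  have l: "?l \<in> carrier L" using c by (simp add: lmeet_closed ljoin_closed)
  have "le ?l (z \<otimes> inv m \<otimes> x)" if x: "x \<in> {a, b}" for x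
  proof (rule le_trans[OF _ step])
    show "le ?l (ljoin L z x)"
      using x l c le_refl[OF l] le_lmeet_iff[of "ljoin L z a" "ljoin L z b" ?l] by (auto simp: ljoin_closed)
  qed (use x l m c in \<open>auto simp: ljoin_closed\<close>)
  \<comment> \<open>The trailing \<open>\<one>\<close> brings the products into the two-sided form
    of \<open>mult_lmeet_distrib\<close>.\<close>
  then have "le ?l (lmeet L (z \<otimes> inv m \<otimes> a \<otimes> \<one>) (z \<otimes> inv m \<otimes> b \<otimes> \<one>))"
    using l m c by (simp add: le_lmeet_iff)
  then have "le ?l (z \<otimes> inv m \<otimes> m)"
    using mult_lmeet_distrib[of a b "z \<otimes> inv m" \<one>] m c by (simp add: m_def)
  then have "le ?l z" using m c by (simp add: m_assoc)
  moreover have "le z (ljoin L z x)" if "x \<in> carrier L" for x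
    using ljoin_le_iff[of z x "ljoin L z x"] le_refl[of "ljoin L z x"] that c by (simp add: ljoin_closed)
  then have "le z ?l" using c by (simp add: ljoin_closed le_lmeet_iff)
  ultimately show ?thesis using le_antisym l c by blast
qed

text \<open>With \<open>p\<^sub>k = e \<sqinter> a \<sqinter> \<dots> \<sqinter> a\<^sup>k\<close>, the assumption for \<open>n = k + 1\<close> gives \<open>p\<^sub>k = p\<^sub>k\<^sub>+\<^sub>1 = e \<sqinter> a p\<^sub>k \<le> a p\<^sub>k\<close>,
  and \<open>p\<^sub>k\<close> cancels.\<close>

lemma one_le_of_one_le_pow:
  assumes a: "a \<in> carrier L" and n: "n > 0" and le: "le \<one> (a [^] (n::nat))"
  shows "le \<one> a"
proof -
  define p where "p = rec_nat \<one> (\<lambda>k q. lmeet L \<one> (a \<otimes> q))"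
  have p0: "p 0 = \<one>" and pS: "p (Suc k) = lmeet L \<one> (a \<otimes> p k)" for k by (simp_all add: p_def)
  have pc: "p k \<in> carrier L" for k by (induction k) (simp_all add: p0 pS lmeet_closed a)
  \<comment> \<open>This identifies \<open>p k\<close> as the meet of the powers of \<open>a\<close>
    up to \<open>k\<close>.\<close>
  have le_p: "le z (p k) \<longleftrightarrow> (\<forall>i\<le>k. le z (a [^] i))" if "z \<in> carrier L" for z k
    using that
  proof (induction k arbitrary: z)
    case (Suc k)
    have "a \<otimes> a [^] i = a [^] Suc i" for i :: nat
      using a nat_pow_Suc2 by simp
    moreover have "(\<forall>i\<le>Suc k. P i) \<longleftrightarrow> P 0 \<and> (\<forall>i\<le>k. P (Suc i))" for P
      by (metis Suc_le_mono le0 not0_implies_Suc)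
    ultimately show ?case using Suc a pc
      by (simp add: pS le_lmeet_iff le_mult_left_iff[of z] del: nat_pow_Suc)
        (simp add: le_mult_left_iff[symmetric] del: nat_pow_Suc)
  qed (simp add: p0)
  obtain k where k: "n = Suc k" using n by (cases n) auto
  have "p k = p (Suc k)"
  proof (rule ge_cong_iff)
    fix z assume z: "z \<in> carrier L"
    \<comment> \<open>A lower bound of \<open>p k\<close> lies below the zeroth power, so the
      assumption already puts it below the one new power \<open>a [^] n\<close>.\<close>
    have "le z \<one> \<Longrightarrow> le z (a [^] n)" using le_trans[OF _ le z] a by simp
    then show "le z (p k) \<longleftrightarrow> le z (p (Suc k))"
      using z by (auto simp: le_p k le_Suc_eq simp del: nat_pow_Suc dest: spec[of _ 0])
  qed (simp_all add: pc)
  then have "le (p k) (a \<otimes> p k)" using pS[of k] le_lmeet_iff[of \<one> "a \<otimes> p k" "p k"] le_refl[OF pc] a pc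
    by simp
  then show ?thesis using le_mult_right_iff[of "p k" a "p k"] a pc by simp
qed

end

subsection \<open>Words in lattice-ordered groups\<close>

locale lterm_interpretation = lgroup L for L :: "('a, 'm) lgroup_scheme" (structure) +
  fixes h :: "'x lterm \<Rightarrow> 'a"
  assumes lterm_hom: "h \<in> lterm_hom L"
begin

lemma hom_simps [simp]:
  "h t \<in> carrier L" "h One = \<one>" "h (Inv s) = inv (h s)" "h (Mul s t) = h s \<otimes> h t"
  "h (Meet s t) = lmeet L (h s) (h t)" "h (Join s t) = ljoin L (h s) (h t)"
  using lterm_hom by (auto simp: lterm_hom_def)

lemma hom_word_term_append: "h (word_term (u @ v)) = h (word_term u) \<otimes> h (word_term v)"
  by (induction u) (simp_all add: m_assoc)

lemma hom_letter_inv: "h (letter_term (letter_inv a)) = inv (h (letter_term a))"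
  by (cases a) simp

lemma hom_cancel_Cons: "h (word_term (cancel_Cons a w)) = h (letter_term a) \<otimes> h (word_term w)"
  by (cases w) (auto simp: hom_letter_inv m_assoc[symmetric])

lemma hom_reduce: "h (word_term (reduce w)) = h (word_term w)"
  by (induction w) (simp_all add: reduce_def hom_cancel_Cons)

text \<open>Evaluating words in \<open>L\<close> is a homomorphism on the free group. Its kernel is
  normal and contains \<open>R\<close>, so it contains the normal closure.\<close>

lemma word_class_eq_one_imp:
  assumes R: "R \<subseteq> carrier (free_group X)" and rel: "\<forall>r\<in>R. h (word_term r) = \<one>"
    and w: "w \<in> words X" and eq: "word_class X R w = \<one>\<^bsub>presented_group X R\<^esub>"
  shows "h (word_term w) = \<one>"
proof -
  interpret F: group "free_group X" by (rule group_free_group)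
  let ?K = "normal_closure (free_group X) R"
  interpret hom: group_hom "free_group X" L "\<lambda>w. h (word_term w)"
    by (intro group_hom.intro group_hom_axioms.intro F.is_group is_group homI)
      (simp_all add: free_group_def hom_reduce hom_word_term_append)
  have "?K \<subseteq> kernel (free_group X) L (\<lambda>w. h (word_term w))"
    unfolding normal_closure_def using hom.normal_kernel R rel by (intro Inter_lower) (auto simp: kernel_def)
  moreover have "reduce w \<in> carrier (free_group X)"
    using w by (simp add: free_group_def reduce_in_words)
  moreover have "?K #>\<^bsub>free_group X\<^esub> reduce w = ?K"
    using eq by (simp add: word_class_def presented_group_def FactGroup_def)
  ultimately have "reduce w \<in> kernel (free_group X) L (\<lambda>w. h (word_term w))"
    using F.coset_join1 normal_normal_closure[OF F.is_group R]
    by (metis normal_imp_subgroup subgroup.subset subsetD)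
  then show ?thesis by (simp add: kernel_def hom_reduce)
qed

lemma big_join_le_iff:
  "ts \<noteq> [] \<Longrightarrow> z \<in> carrier L \<Longrightarrow> le (h (big_join ts)) z \<longleftrightarrow> (\<forall>t\<in>set ts. le (h t) z)"
  by (induction ts rule: big_join.induct) (simp_all add: ljoin_le_iff)

end

lemma reduce_in_carrier: "w \<in> words X \<Longrightarrow> reduce w \<in> carrier (free_group X)"
  by (simp add: free_group_def reduce_in_words)

lemma word_class_in_carrier: "w \<in> words X \<Longrightarrow> word_class X R w \<in> carrier (presented_group X R)"
  using reduce_in_carrier[of w X]
  by (auto simp: word_class_def presented_group_def FactGroup_def RCOSETS_def)

lemma word_class_append:
  assumes "R \<subseteq> carrier (free_group X)" "u \<in> words X" "v \<in> words X"
  shows "word_class X R (u @ v) = word_class X R u \<otimes>\<^bsub>presented_group X R\<^esub> word_class X R v"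
  using normal.rcos_sum[OF normal_normal_closure[OF group_free_group assms(1)],
      of "reduce u" "reduce v"] assms(2,3)
  by (simp add: word_class_def presented_group_def FactGroup_def reduce_in_carrier)
    (simp add: free_group_def)

lemma word_class_Nil:
  assumes "R \<subseteq> carrier (free_group X)"
  shows "word_class X R [] = \<one>\<^bsub>presented_group X R\<^esub>"
proof -
  interpret F: group "free_group X" by (rule group_free_group)
  interpret normal "normal_closure (free_group X) R" "free_group X"
    by (rule normal_normal_closure[OF group_free_group assms])
  show ?thesis using F.coset_mult_one[OF subset]
    by (simp add: word_class_def presented_group_def FactGroup_def free_group_def reduce_def)
qed

lemma word_class_relator:
  assumes "R \<subseteq> carrier (free_group X)" "r \<in> R"
  shows "word_class X R r = \<one>\<^bsub>presented_group X R\<^esub>"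
proof -
  interpret F: group "free_group X" by (rule group_free_group)
  interpret normal "normal_closure (free_group X) R" "free_group X"
    by (rule normal_normal_closure[OF group_free_group assms(1)])
  have "r \<in> normal_closure (free_group X) R" using assms(2) by (auto simp: normal_closure_def)
  moreover have "reduce r = r" using assms by (auto simp: free_group_def)
  ultimately show ?thesis using rcos_const
    by (simp add: word_class_def presented_group_def FactGroup_def)
qed

text \<open>Says \<open>e \<le> \<Squnion>A\<close> without presupposing that the join exists.\<close>

definition one_le_Sup :: "('a, 'm) lgroup_scheme \<Rightarrow> 'a set \<Rightarrow> bool" where
  "one_le_Sup L A \<longleftrightarrow> (\<forall>z\<in>carrier L. (\<forall>a\<in>A. lmeet L a z = a) \<longrightarrow> lmeet L \<one>\<^bsub>L\<^esub> z = \<one>\<^bsub>L\<^esub>)"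

text \<open>A product of \<open>n\<close> generators below \<open>z\<close> is below \<open>z\<^sup>n\<close>.\<close>

lemma (in lterm_interpretation) one_le_Sup_of_subsemigroup:
  assumes R: "R \<subseteq> carrier (free_group X)" and rel: "\<forall>r\<in>R. h (word_term r) = \<one>"
    and W: "W \<subseteq> words X"
    and one: "\<one>\<^bsub>presented_group X R\<^esub> \<in> subsemigroup_gen (presented_group X R) (word_class X R ` W)"
  shows "one_le_Sup L ((\<lambda>w. h (word_term w)) ` W)"
  unfolding one_le_Sup_def
proof (intro ballI impI)
  fix z assume z: "z \<in> carrier L" and ub: "\<forall>a\<in>(\<lambda>w. h (word_term w)) ` W. le a z"
  \<comment> \<open>Since \<open>h\<close> evaluates terms and not group elements, the induction
    carries a word \<open>u\<close> naming \<open>g\<close>. The exponent \<open>n\<close> counts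
    the generators used; its positivity is needed to extract the root at the end.\<close>
  have "\<exists>u (n::nat). u \<in> words X \<and> n > 0 \<and> g = word_class X R u \<and> le (h (word_term u)) (z [^] n)"
    if "g \<in> subsemigroup_gen (presented_group X R) (word_class X R ` W)" for g
    using that
  proof induction
    case (base g)
    then obtain u where "u \<in> W" "g = word_class X R u" by auto
    then show ?case using W ub z by (intro exI[of _ u] exI[of _ "1::nat"]) auto
  next
    case (mult a b)
    then obtain u v and m n :: nat where
      "u \<in> words X" "m > 0" "a = word_class X R u" "le (h (word_term u)) (z [^] m)"
      "v \<in> words X" "n > 0" "b = word_class X R v" "le (h (word_term v)) (z [^] n)" by blast
    then show ?case using word_class_append[OF R] z
      by (intro exI[of _ "u @ v"] exI[of _ "m + n"])
        (auto simp: hom_word_term_append nat_pow_mult[symmetric] intro!: le_mult)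
  qed
  from this[OF one] obtain u and n :: nat where u: "u \<in> words X" "n > 0"
    "\<one>\<^bsub>presented_group X R\<^esub> = word_class X R u" "le (h (word_term u)) (z [^] n)" by blast
  then have "le \<one> (z [^] n)" using word_class_eq_one_imp[OF R rel] by metis
  then show "le \<one> z" using one_le_of_one_le_pow z u(2) by blast
qed

primrec lterm_eval :: "('a, 'm) lgroup_scheme \<Rightarrow> ('x \<Rightarrow> 'a) \<Rightarrow> 'x lterm \<Rightarrow> 'a" where
  "lterm_eval L v (Var x) = v x"
| "lterm_eval L v One = \<one>\<^bsub>L\<^esub>"
| "lterm_eval L v (Inv s) = inv\<^bsub>L\<^esub> (lterm_eval L v s)"
| "lterm_eval L v (Mul s t) = lterm_eval L v s \<otimes>\<^bsub>L\<^esub> lterm_eval L v t"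
| "lterm_eval L v (Meet s t) = lmeet L (lterm_eval L v s) (lterm_eval L v t)"
| "lterm_eval L v (Join s t) = ljoin L (lterm_eval L v s) (lterm_eval L v t)"

lemma lterm_eval_hom:
  assumes "lgroup L" and "range v \<subseteq> carrier L"
  shows "lterm_eval L v \<in> lterm_hom L"
proof -
  interpret lgroup L by fact
  have "lterm_eval L v t \<in> carrier L" for t
    using assms(2) by (induction t) (auto simp: lmeet_closed ljoin_closed)
  then show ?thesis by (auto simp: lterm_hom_def)
qed

subsection \<open>Automorphisms of a chain\<close>

text \<open>The automorphisms are permutations of the ambient type that fix every point outside \<open>S\<close>.\<close>

definition chain_aut :: "'g set \<Rightarrow> ('g \<times> 'g) set \<Rightarrow> ('g \<Rightarrow> 'g) lgroup" where
  "chain_aut S r = \<lparr>carrier = {f. bij f \<and> (\<forall>x. x \<notin> S \<longrightarrow> f x = x) \<and> (\<forall>(x, y)\<in>r. (f x, f y) \<in> r)},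
     mult = (\<circ>), one = id,
     lmeet = (\<lambda>f g x. if (f x, g x) \<in> r then f x else g x),
     ljoin = (\<lambda>f g x. if (f x, g x) \<in> r then g x else f x)\<rparr>"

locale chain =
  fixes S :: "'g set" and r :: "('g \<times> 'g) set"
  assumes linear_order: "linear_order_on S r"
begin

lemma order_facts:
  "x \<in> S \<Longrightarrow> (x, x) \<in> r"
  "(x, y) \<in> r \<Longrightarrow> x \<in> S" "(x, y) \<in> r \<Longrightarrow> y \<in> S"
  "(x, y) \<in> r \<Longrightarrow> (y, z) \<in> r \<Longrightarrow> (x, z) \<in> r"
  "(x, y) \<in> r \<Longrightarrow> (y, x) \<in> r \<Longrightarrow> x = y"
  "x \<in> S \<Longrightarrow> y \<in> S \<Longrightarrow> (x, y) \<notin> r \<Longrightarrow> (y, x) \<in> r"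
proof -
  have *: "r \<subseteq> S \<times> S" "\<forall>x\<in>S. (x, x) \<in> r" "trans r" "antisym r" "total_on S r"
    using linear_order
    by (auto simp: linear_order_on_def partial_order_on_def preorder_on_def refl_on_def)
  show "(x, x) \<in> r" if "x \<in> S" using *(2) that by blast
  then show "(y, x) \<in> r" if "x \<in> S" "y \<in> S" "(x, y) \<notin> r"
    using *(5) that unfolding total_on_def by metis
  show "x \<in> S" "y \<in> S" if "(x, y) \<in> r" using *(1) that by blast+
  show "(x, z) \<in> r" if "(x, y) \<in> r" "(y, z) \<in> r" using *(3) that by (rule transD)
  show "x = y" if "(x, y) \<in> r" "(y, x) \<in> r" using *(4) that by (rule antisymD)
qed

abbreviation "Aut \<equiv> carrier (chain_aut S r)"

lemma chain_aut_iff: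
  "f \<in> Aut \<longleftrightarrow> bij f \<and> (\<forall>x. x \<notin> S \<longrightarrow> f x = x) \<and> (\<forall>(x, y)\<in>r. (f x, f y) \<in> r)"
  by (simp add: chain_aut_def)

lemma chain_aut_simps [simp]:
  "mult (chain_aut S r) f g = f \<circ> g" "one (chain_aut S r) = id"
  "lmeet (chain_aut S r) f g x = (if (f x, g x) \<in> r then f x else g x)"
  "ljoin (chain_aut S r) f g x = (if (f x, g x) \<in> r then g x else f x)"
  by (simp_all add: chain_aut_def)

lemma Aut_out: "f \<in> Aut \<Longrightarrow> x \<notin> S \<Longrightarrow> f x = x"
  by (simp add: chain_aut_iff)

lemma Aut_mono: "f \<in> Aut \<Longrightarrow> (x, y) \<in> r \<Longrightarrow> (f x, f y) \<in> r"
  unfolding chain_aut_iff by blast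

lemma Aut_in: "f \<in> Aut \<Longrightarrow> x \<in> S \<Longrightarrow> f x \<in> S"
  using order_facts(1,2) Aut_mono by blast

lemma Aut_inj: "f \<in> Aut \<Longrightarrow> f x = f y \<longleftrightarrow> x = y"
  unfolding chain_aut_iff bij_def by (blast dest: injD)

lemma Aut_surj: "f \<in> Aut \<Longrightarrow> \<exists>x. f x = y"
  unfolding chain_aut_iff bij_def by (metis surjD)

text \<open>Distinct points of a chain are comparable, so injectivity need only be checked on
  related pairs. Points outside \<open>S\<close> are fixed and cannot collide with images of points
  of \<open>S\<close>.\<close>

lemma AutI:
  assumes "\<And>x. x \<notin> S \<Longrightarrow> f x = x" and "\<And>x y. (x, y) \<in> r \<Longrightarrow> (f x, f y) \<in> r"
    and "\<And>x y. (x, y) \<in> r \<Longrightarrow> x \<noteq> y \<Longrightarrow> f x \<noteq> f y" and "\<And>y. y \<in> S \<Longrightarrow> \<exists>x. f x = y"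
  shows "f \<in> Aut"
proof -
  have in_S: "f x \<in> S" if "x \<in> S" for x using that assms(2) order_facts(1,2) by blast
  have "x = y" if "f x = f y" for x y
    using that assms(1,3) in_S order_facts(6) by metis
  moreover have "\<exists>x. f x = y" for y using assms(1,4) by metis
  ultimately have "bij f" by (metis bijI injI surjI someI_ex)
  then show ?thesis unfolding chain_aut_iff using assms(1,2) by blast
qed

lemma inv_Aut: assumes f: "f \<in> Aut" shows "the_inv f \<in> Aut" "the_inv f \<circ> f = id"
proof -
  have b: "bij f" using f by (simp add: chain_aut_iff)
  have i: "the_inv f (f x) = x" "f (the_inv f x) = x" for x
    using b by (simp_all add: the_inv_f_f bij_def f_the_inv_into_f)
  show "the_inv f \<circ> f = id" by (simp add: fun_eq_iff i)
  show "the_inv f \<in> Aut"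
  proof (rule AutI)
    show "the_inv f x = x" if "x \<notin> S" for x using i Aut_out[OF f that] by metis
    have in_S: "the_inv f x \<in> S" if "x \<in> S" for x using i Aut_out[OF f] that by metis
    \<comment> \<open>If the preimages were in the opposite order, monotonicity of \<open>f\<close>
      and antisymmetry would force \<open>x = y\<close>.\<close>
    show "(the_inv f x, the_inv f y) \<in> r" if "(x, y) \<in> r" for x y
      using that i in_S order_facts Aut_mono[OF f] by metis
    show "the_inv f x \<noteq> the_inv f y" if "x \<noteq> y" for x y using that i by metis
    show "\<exists>x. the_inv f x = y" for y using i by blast
  qed
qed

text \<open>Supplies the monotonicity and injectivity that \<open>AutI\<close> requires of pointwise
  meets and joins. For the strict parts, equality of the two minima or maxima would squeeze one of
  the pairs to a point.\<close>

lemma min_max_mono: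
  assumes "(a, b) \<in> r" "(c, d) \<in> r"
  shows "(if (a, c) \<in> r then a else c, if (b, d) \<in> r then b else d) \<in> r"
    and "(if (a, c) \<in> r then c else a, if (b, d) \<in> r then d else b) \<in> r"
    and "a \<noteq> b \<Longrightarrow> c \<noteq> d \<Longrightarrow> (if (a, c) \<in> r then a else c) \<noteq> (if (b, d) \<in> r then b else d)"
    and "a \<noteq> b \<Longrightarrow> c \<noteq> d \<Longrightarrow> (if (a, c) \<in> r then c else a) \<noteq> (if (b, d) \<in> r then d else b)"
proof -
  have "(a, c) \<in> r \<or> (c, a) \<in> r" "(b, d) \<in> r \<or> (d, b) \<in> r"
    using assms order_facts(2,3,6) by blast+
  moreover have "(a, c) \<in> r \<Longrightarrow> (a, d) \<in> r" "(c, a) \<in> r \<Longrightarrow> (c, b) \<in> r"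
    "(b, d) \<in> r \<Longrightarrow> (a, d) \<in> r" "(d, b) \<in> r \<Longrightarrow> (c, b) \<in> r"
    using assms order_facts(4) by blast+
  ultimately show "(if (a, c) \<in> r then a else c, if (b, d) \<in> r then b else d) \<in> r"
    "(if (a, c) \<in> r then c else a, if (b, d) \<in> r then d else b) \<in> r"
    using assms by auto
  have *: "x = y" "y = z" if "(x, y) \<in> r" "(y, z) \<in> r" "x = z" for x y z
    using that order_facts(5) by blast+
  show "(if (a, c) \<in> r then a else c) \<noteq> (if (b, d) \<in> r then b else d)"
    "(if (a, c) \<in> r then c else a) \<noteq> (if (b, d) \<in> r then d else b)" if "a \<noteq> b" "c \<noteq> d"
    using that assms \<open>(a, c) \<in> r \<or> (c, a) \<in> r\<close> \<open>(b, d) \<in> r \<or> (d, b) \<in> r\<close>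
      *[of a c d] *[of c a b] *[of a b d] *[of c d b] by auto
qed

lemma lmeet_in_Aut: assumes f: "f \<in> Aut" and g: "g \<in> Aut" shows "lmeet (chain_aut S r) f g \<in> Aut"
proof (rule AutI)
  fix x y assume xy: "(x, y) \<in> r"
  have fg: "(f x, f y) \<in> r" "(g x, g y) \<in> r" using xy f g Aut_mono by auto
  then show m: "(lmeet (chain_aut S r) f g x, lmeet (chain_aut S r) f g y) \<in> r"
    by (simp only: chain_aut_simps min_max_mono)
  assume "x \<noteq> y"
  then have "f x \<noteq> f y" "g x \<noteq> g y" using f g Aut_inj by auto
  then show "lmeet (chain_aut S r) f g x \<noteq> lmeet (chain_aut S r) f g y"
    using fg by (simp only: chain_aut_simps min_max_mono not_False_eq_True)
next
  fix y assume y: "y \<in> S"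
  \<comment> \<open>The larger of the two preimages is mapped to \<open>y\<close> by the meet: one
    function takes the value \<open>y\<close> there and the other a value not below it.\<close>
  obtain u v where uv: "f u = y" "g v = y" using Aut_surj f g by metis
  then have "u \<in> S" "v \<in> S" using y Aut_out f g by metis+
  then consider "(u, v) \<in> r" | "(v, u) \<in> r" using order_facts(6) by blast
  then show "\<exists>x. lmeet (chain_aut S r) f g x = y"
  proof cases
    case 1
    then have "(f u, f v) \<in> r" using Aut_mono f by blast
    then show ?thesis using uv order_facts(5)[of y "f v"] by (intro exI[of _ v]) auto
  next
    case 2
    then have "(g v, g u) \<in> r" using Aut_mono g by blast
    then show ?thesis using uv by (intro exI[of _ u]) auto
  qed
qed (simp add: Aut_out[OF f] Aut_out[OF g])

lemma ljoin_in_Aut: assumes f: "f \<in> Aut" and g: "g \<in> Aut" shows "ljoin (chain_aut S r) f g \<in> Aut"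
proof (rule AutI)
  fix x y assume xy: "(x, y) \<in> r"
  have fg: "(f x, f y) \<in> r" "(g x, g y) \<in> r" using xy f g Aut_mono by auto
  then show m: "(ljoin (chain_aut S r) f g x, ljoin (chain_aut S r) f g y) \<in> r"
    by (simp only: chain_aut_simps min_max_mono)
  assume "x \<noteq> y"
  then have "f x \<noteq> f y" "g x \<noteq> g y" using f g Aut_inj by auto
  then show "ljoin (chain_aut S r) f g x \<noteq> ljoin (chain_aut S r) f g y"
    using fg by (simp only: chain_aut_simps min_max_mono not_False_eq_True)
next
  fix y assume y: "y \<in> S"
  \<comment> \<open>Dually, the smaller preimage serves for the join.\<close>
  obtain u v where uv: "f u = y" "g v = y" using Aut_surj f g by metis
  then have "u \<in> S" "v \<in> S" using y Aut_out f g by metis+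
  then consider "(u, v) \<in> r" | "(v, u) \<in> r" using order_facts(6) by blast
  then show "\<exists>x. ljoin (chain_aut S r) f g x = y"
  proof cases
    case 1
    then have "(g u, g v) \<in> r" using Aut_mono g by blast
    then show ?thesis using uv order_facts(5)[of y "g u"] by (intro exI[of _ u]) auto
  next
    case 2
    then have "(f v, f u) \<in> r" using Aut_mono f by blast
    then show ?thesis using uv by (intro exI[of _ v]) auto
  qed
qed (simp add: Aut_out[OF f] Aut_out[OF g])

text \<open>Off \<open>S\<close> both functions fix the point, so both branches of the meet agree
  there and only points of \<open>S\<close> impose a condition.\<close>

lemma lmeet_eq_left_iff:
  assumes "f \<in> Aut" "g \<in> Aut"
  shows "lmeet (chain_aut S r) f g = f \<longleftrightarrow> (\<forall>x\<in>S. (f x, g x) \<in> r)"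
proof -
  have "lmeet (chain_aut S r) f g x = f x \<longleftrightarrow> (x \<in> S \<longrightarrow> (f x, g x) \<in> r)" for x
    using Aut_in[OF assms(1), of x] order_facts(1)[of "f x"] Aut_out[OF assms(1), of x]
      Aut_out[OF assms(2), of x] by (cases "x \<in> S") auto
  then show ?thesis by (auto simp only: fun_eq_iff)
qed

lemma group_chain_aut: "group (chain_aut S r)"
proof (rule groupI)
  fix f g assume fg: "f \<in> Aut" "g \<in> Aut"
  then show "f \<otimes>\<^bsub>chain_aut S r\<^esub> g \<in> Aut"
    by (auto simp: chain_aut_iff bij_comp)
next
  fix f assume "f \<in> Aut"
  then show "\<exists>g\<in>Aut. g \<otimes>\<^bsub>chain_aut S r\<^esub> f = \<one>\<^bsub>chain_aut S r\<^esub>"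
    using inv_Aut by auto
qed (auto simp: chain_aut_iff comp_assoc)

lemma lgroup_chain_aut: "lgroup (chain_aut S r)"
proof (intro lgroup.intro lgroup_axioms.intro group_chain_aut lmeet_in_Aut ljoin_in_Aut)
  fix a b assume a: "a \<in> Aut" and b: "b \<in> Aut"
  have "lmeet (chain_aut S r) a b x = lmeet (chain_aut S r) b a x \<and>
    ljoin (chain_aut S r) a b x = ljoin (chain_aut S r) b a x \<and>
    lmeet (chain_aut S r) a (ljoin (chain_aut S r) a b) x = a x \<and>
    ljoin (chain_aut S r) a (lmeet (chain_aut S r) a b) x = a x" for x
  proof -
    \<comment> \<open>The first case includes every point outside \<open>S\<close>; inside, totality
      and antisymmetry leave exactly one strict comparison.\<close>
    consider "a x = b x" | "(a x, b x) \<in> r" "(b x, a x) \<notin> r" | "(b x, a x) \<in> r" "(a x, b x) \<notin> r"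
      using Aut_in[OF a, of x] Aut_in[OF b, of x] Aut_out[OF a, of x] Aut_out[OF b, of x]
        order_facts(5,6)[of "a x" "b x"] by metis
    then show ?thesis by cases simp_all
  qed
  then show "lmeet (chain_aut S r) a b = lmeet (chain_aut S r) b a"
    "ljoin (chain_aut S r) a b = ljoin (chain_aut S r) b a"
    "lmeet (chain_aut S r) a (ljoin (chain_aut S r) a b) = a"
    "ljoin (chain_aut S r) a (lmeet (chain_aut S r) a b) = a"
    by (intro ext; blast)+
next
  fix a b c assume abc: "a \<in> Aut" "b \<in> Aut" "c \<in> Aut"
  have "lmeet (chain_aut S r) (lmeet (chain_aut S r) a b) c x = lmeet (chain_aut S r) a (lmeet (chain_aut S r) b c) x
      \<and> ljoin (chain_aut S r) (ljoin (chain_aut S r) a b) c x = ljoin (chain_aut S r) a (ljoin (chain_aut S r) b c) x" for x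
  proof (cases "x \<in> S")
    case True
    then have "a x \<in> S" "b x \<in> S" "c x \<in> S" using abc Aut_in by auto
    note tot = order_facts(6)[OF this(1,2)] order_facts(6)[OF this(2,3)] order_facts(6)[OF this(1,3)]
    show ?thesis
      using tot order_facts(4)[of "a x" "b x" "c x"] order_facts(4)[of "c x" "b x" "a x"]
        order_facts(5)[of "a x" "c x"]
      by (auto)
  next
    case False
    then show ?thesis using abc[THEN Aut_out] by simp
  qed
  then show "lmeet (chain_aut S r) (lmeet (chain_aut S r) a b) c = lmeet (chain_aut S r) a (lmeet (chain_aut S r) b c)"
    "ljoin (chain_aut S r) (ljoin (chain_aut S r) a b) c = ljoin (chain_aut S r) a (ljoin (chain_aut S r) b c)"
    by (intro ext; blast)+
next
  fix a b c d assume c: "a \<in> Aut" "b \<in> Aut" "c \<in> Aut" "d \<in> Aut"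
    and le: "lmeet (chain_aut S r) a b = a"
  interpret group "chain_aut S r" by (rule group_chain_aut)
  have cl: "c \<circ> a \<circ> d \<in> Aut" "c \<circ> b \<circ> d \<in> Aut" using m_closed c by auto
  have "((c \<circ> a \<circ> d) x, (c \<circ> b \<circ> d) x) \<in> r" if "x \<in> S" for x
  proof -
    \<comment> \<open>The right factor \<open>d\<close> only shifts the point of comparison, and the
      left factor \<open>c\<close> is monotone.\<close>
    have "(a (d x), b (d x)) \<in> r" using le[unfolded lmeet_eq_left_iff[OF c(1,2)]] Aut_in[OF c(4) that] by blast
    then show ?thesis using Aut_mono[OF c(3)] by simp
  qed
  then show "lmeet (chain_aut S r) (c \<otimes>\<^bsub>chain_aut S r\<^esub> a \<otimes>\<^bsub>chain_aut S r\<^esub> d)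
      (c \<otimes>\<^bsub>chain_aut S r\<^esub> b \<otimes>\<^bsub>chain_aut S r\<^esub> d) = c \<otimes>\<^bsub>chain_aut S r\<^esub> a \<otimes>\<^bsub>chain_aut S r\<^esub> d"
    unfolding chain_aut_simps lmeet_eq_left_iff[OF cl] by blast
qed

end

section \<open>Left-orders from subsemigroups, and the order-theoretic form of the Identity
  Problem\<close>

lemma subsemigroup_gen_closed:
  assumes "group G" "A \<subseteq> carrier G" "a \<in> subsemigroup_gen G A"
  shows "a \<in> carrier G"
  using assms(3) by induction (use assms group.is_monoid monoid.m_closed in \<open>auto simp: group_def\<close>)

text \<open>Let \<open>a\<close> lie strictly below \<open>b\<close> when
  \<open>inv b \<otimes> a\<close> is in the subsemigroup. Closure under products gives
  transitivity, absence of the identity gives antisymmetry, and left invariance holds because a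
  common left factor cancels.\<close>

lemma exists_left_order_below_one:
  assumes G: "group G" and flo: "fully_left_orderable G" and A: "A \<subseteq> carrier G"
    and one: "\<one>\<^bsub>G\<^esub> \<notin> subsemigroup_gen G A"
  obtains r where "left_order G r" and "\<And>a. a \<in> A \<Longrightarrow> (a, \<one>\<^bsub>G\<^esub>) \<in> r \<and> a \<noteq> \<one>\<^bsub>G\<^esub>"
proof -
  interpret group G by fact
  have inv_cancel: "x \<otimes>\<^bsub>G\<^esub> (inv\<^bsub>G\<^esub> x \<otimes>\<^bsub>G\<^esub> y) = y" "inv\<^bsub>G\<^esub> x \<otimes>\<^bsub>G\<^esub> (x \<otimes>\<^bsub>G\<^esub> y) = y"
    if "x \<in> carrier G" "y \<in> carrier G" for x y
    using that by (simp_all add: m_assoc[symmetric])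
  let ?P = "subsemigroup_gen G A"
  have P: "a \<in> ?P \<Longrightarrow> a \<in> carrier G" for a using subsemigroup_gen_closed[OF G A] .
  define r where "r = {(a, b). a \<in> carrier G \<and> b \<in> carrier G \<and> (a = b \<or> inv\<^bsub>G\<^esub> b \<otimes>\<^bsub>G\<^esub> a \<in> ?P)}"
  have *: "inv\<^bsub>G\<^esub> c \<otimes>\<^bsub>G\<^esub> a \<in> ?P" if "inv\<^bsub>G\<^esub> b \<otimes>\<^bsub>G\<^esub> a \<in> ?P" "inv\<^bsub>G\<^esub> c \<otimes>\<^bsub>G\<^esub> b \<in> ?P"
    "a \<in> carrier G" "b \<in> carrier G" "c \<in> carrier G" for a b c
  proof -
    have "(inv\<^bsub>G\<^esub> c \<otimes>\<^bsub>G\<^esub> b) \<otimes>\<^bsub>G\<^esub> (inv\<^bsub>G\<^esub> b \<otimes>\<^bsub>G\<^esub> a) = inv\<^bsub>G\<^esub> c \<otimes>\<^bsub>G\<^esub> a"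
      using that(3-5) inv_cancel by (simp add: m_assoc)
    then show ?thesis using subsemigroup_gen.mult[OF that(2,1)] by simp
  qed
  have "partial_left_order G r"
    unfolding partial_left_order_def partial_order_on_def preorder_on_def
  proof (intro conjI ballI impI)
    show "trans r" using * by (auto simp: r_def trans_def)
    show "antisym r" using *[of _ _ _] one by (auto simp: r_def antisym_def) (metis l_inv)
    show "(c \<otimes>\<^bsub>G\<^esub> a, c \<otimes>\<^bsub>G\<^esub> b) \<in> r"
      if "a \<in> carrier G" "b \<in> carrier G" "c \<in> carrier G" "(a, b) \<in> r" for a b c
    proof -
      have "inv\<^bsub>G\<^esub> (c \<otimes>\<^bsub>G\<^esub> b) \<otimes>\<^bsub>G\<^esub> (c \<otimes>\<^bsub>G\<^esub> a) = inv\<^bsub>G\<^esub> b \<otimes>\<^bsub>G\<^esub> a"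
        using that inv_cancel by (simp add: inv_mult_group m_assoc)
      then show ?thesis using that by (auto simp: r_def)
    qed
  qed (auto simp: r_def refl_on_def)
  then obtain r' where r': "left_order G r'" "r \<subseteq> r'" using flo by (auto simp: fully_left_orderable_def)
  have "(a, \<one>\<^bsub>G\<^esub>) \<in> r' \<and> a \<noteq> \<one>\<^bsub>G\<^esub>" if "a \<in> A" for a
  proof -
    have "a \<in> ?P" using that by (rule subsemigroup_gen.base)
    then show ?thesis using one r'(2) P by (auto simp: r_def)
  qed
  then show ?thesis using that r'(1) by blast
qed

text \<open>In the counter-model each generator acts by left translation by its class. Hence every
  word acts by its class, relators act trivially, and a word applied to the identity returns its
  class.\<close>

lemma lmeet_One_big_join_imp_subsemigroup:
  assumes R: "R \<subseteq> carrier (free_group X)" and flo: "fully_left_orderable (presented_group X R)"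
    and ws: "ws \<noteq> []" "set ws \<subseteq> words X"
    and cons: "relator_eqns R \<Turnstile>LG leq_eqn One (big_join (map word_term ws))"
  shows "\<one>\<^bsub>presented_group X R\<^esub> \<in> subsemigroup_gen (presented_group X R) (word_class X R ` set ws)"
proof (rule ccontr)
  let ?G = "presented_group X R"
  assume neg: "\<one>\<^bsub>?G\<^esub> \<notin> subsemigroup_gen ?G (word_class X R ` set ws)"
  interpret G: group ?G by (rule group_presented_group[OF R])
  have wsG: "word_class X R ` set ws \<subseteq> carrier ?G" using ws(2) word_class_in_carrier by blast
  obtain r where r: "left_order ?G r"
    and below: "\<And>a. a \<in> word_class X R ` set ws \<Longrightarrow> (a, \<one>\<^bsub>?G\<^esub>) \<in> r \<and> a \<noteq> \<one>\<^bsub>?G\<^esub>"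
    using exists_left_order_below_one[OF G.is_group flo wsG neg] by blast
  interpret chain "carrier ?G" r
    using r by (unfold_locales) (simp add: left_order_def partial_left_order_def linear_order_on_def)
  let ?L = "chain_aut (carrier ?G) r"
  interpret L: lgroup ?L by (rule lgroup_chain_aut)
  define m where "m a x = (if x \<in> carrier ?G then a \<otimes>\<^bsub>?G\<^esub> x else x)" for a x
  have m_Aut: "m a \<in> Aut" if a: "a \<in> carrier ?G" for a
  proof (rule AutI)
    show "(m a x, m a y) \<in> r" if "(x, y) \<in> r" for x y
      using that a r order_facts(2,3)[OF that] by (simp add: m_def left_order_def partial_left_order_def)
    show "m a x \<noteq> m a y" if "(x, y) \<in> r" "x \<noteq> y" for x y
      using that a order_facts(2,3)[OF that(1)] by (simp add: m_def)
    show "\<exists>x. m a x = y" if "y \<in> carrier ?G" for y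
      using that a by (intro exI[of _ "inv\<^bsub>?G\<^esub> a \<otimes>\<^bsub>?G\<^esub> y"]) (simp add: m_def G.m_assoc[symmetric])
  qed (simp add: m_def)
  have m_mult: "m (a \<otimes>\<^bsub>?G\<^esub> b) = m a \<circ> m b" if "a \<in> carrier ?G" "b \<in> carrier ?G" for a b
    using that by (auto simp: m_def G.m_assoc fun_eq_iff)
  have m_one: "m \<one>\<^bsub>?G\<^esub> = id" by (auto simp: m_def fun_eq_iff)
  \<comment> \<open>The value \<open>id\<close> off \<open>X\<close> keeps the valuation inside the
    automorphism group.\<close>
  define v where "v x = (if x \<in> X then m (word_class X R [(x, True)]) else id)" for x
  let ?h = "lterm_eval ?L v"
  have letter: "word_class X R [(x, b)] \<in> carrier ?G" if "x \<in> X" for x b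
    using that by (intro word_class_in_carrier) auto
  have hom: "?h \<in> lterm_hom ?L"
    using m_Aut letter L.one_closed by (intro lterm_eval_hom L.lgroup_axioms) (auto simp: v_def)
  interpret h: lterm_interpretation ?L ?h by unfold_locales (rule hom)
  have inv_letter: "word_class X R [(x, False)] \<otimes>\<^bsub>?G\<^esub> word_class X R [(x, True)] = \<one>\<^bsub>?G\<^esub>" if "x \<in> X" for x
    using that word_class_append[OF R, of "[(x, False)]" "[(x, True)]"] word_class_Nil[OF R]
    by (simp add: word_class_def reduce_def)
  have h_letter: "?h (letter_term (x, b)) = m (word_class X R [(x, b)])" if "x \<in> X" for x b
  proof (cases b)
    case False
    have "m (word_class X R [(x, False)]) \<otimes>\<^bsub>?L\<^esub> m (word_class X R [(x, True)]) = \<one>\<^bsub>?L\<^esub>"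
      using inv_letter[OF that] m_mult[OF letter[OF that, of False] letter[OF that, of True]] m_one by simp
    then show ?thesis using L.inv_equality m_Aut letter that False by (simp add: v_def)
  qed (use that in \<open>simp add: v_def\<close>)
  have h_word: "?h (word_term w) = m (word_class X R w)" if "w \<in> words X" for w
    using that
  proof (induction w)
    case (Cons a w)
    obtain x b where a: "a = (x, b)" "x \<in> X" using Cons.hyps by (cases a) auto
    have "word_class X R (a # w) = word_class X R [a] \<otimes>\<^bsub>?G\<^esub> word_class X R w"
      using word_class_append[OF R, of "[a]" w] Cons.hyps by simp
    also have "m \<dots> = m (word_class X R [a]) \<circ> m (word_class X R w)"
      using Cons.hyps a by (intro m_mult word_class_in_carrier) auto
    also have "\<dots> = ?h (word_term (a # w))"
      unfolding word_term.simps h.hom_simps h_letter[OF a(2), of b, folded a(1)] Cons.IH by simp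
    finally show ?case ..
  qed (simp add: word_class_Nil[OF R] m_one)
  have "\<forall>(s, t)\<in>relator_eqns R. ?h s = ?h t"
  proof -
    have "?h (word_term q) = id" if "q \<in> R" for q
      using that h_word[of q] word_class_relator[OF R that] R by (auto simp: free_group_def m_one)
    then show ?thesis by (auto simp: relator_eqns_def)
  qed
  \<comment> \<open>The counter-model consists of permutations and not of sets of terms, so
    consequence is transferred by universality.\<close>
  then have "?h (Meet One (big_join (map word_term ws))) = ?h One"
    by (rule lg_consequence_universal[OF cons[unfolded leq_eqn_def] L.lgroup_axioms hom])
  then have "(\<one>\<^bsub>?G\<^esub>, ?h (big_join (map word_term ws)) \<one>\<^bsub>?G\<^esub>) \<in> r"
    using lmeet_eq_left_iff[of id "?h (big_join (map word_term ws))"] L.one_closed h.hom_simps(1) by simp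
  \<comment> \<open>In a chain a pointwise join is a maximum, so at each point it is attained by one
    of the joinands.\<close>
  moreover have "?h (big_join ts) x \<in> (\<lambda>t. ?h t x) ` set ts" if "ts \<noteq> []" for ts x
    using that by (induction ts rule: big_join.induct) auto
  then have "?h (big_join (map word_term ws)) \<one>\<^bsub>?G\<^esub> \<in> (\<lambda>t. ?h t \<one>\<^bsub>?G\<^esub>) ` word_term ` set ws"
    using ws(1) by (metis list.map_disc_iff list.set_map)
  then obtain w where w: "w \<in> set ws" "?h (big_join (map word_term ws)) \<one>\<^bsub>?G\<^esub> = ?h (word_term w) \<one>\<^bsub>?G\<^esub>"
    by auto
  moreover have "?h (word_term w) \<one>\<^bsub>?G\<^esub> = word_class X R w"
  proof -
    have "w \<in> words X" using w(1) ws(2) by blast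
    then show ?thesis using h_word[of w] word_class_in_carrier[of w X R] by (simp add: m_def)
  qed
  ultimately have "(\<one>\<^bsub>?G\<^esub>, word_class X R w) \<in> r" by simp
  then show False using below[of "word_class X R w"] order_facts(5) w(1) by blast
qed

text \<open>Taking a set of terms makes order, bracketing and repetition of the joinands
  immaterial.\<close>

definition one_le_Sup_valid :: "'x word set \<Rightarrow> 'x lterm set \<Rightarrow> bool" where
  "one_le_Sup_valid R T \<longleftrightarrow> (\<forall>(L :: 'x lterm set lgroup) h. lgroup L \<longrightarrow> h \<in> lterm_hom L \<longrightarrow>
     (\<forall>r\<in>R. h (word_term r) = \<one>\<^bsub>L\<^esub>) \<longrightarrow> one_le_Sup L (h ` T))"

text \<open>Brings consequence into the shape of \<open>one_le_Sup_valid\<close>, so that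
  equivalences between the two can be checked model by model.\<close>

lemma lg_consequence_relator_eqns:
  fixes R :: "'x word set"
  shows "relator_eqns R \<Turnstile>LG E \<longleftrightarrow> (\<forall>(L :: 'x lterm set lgroup) h. lgroup L \<longrightarrow> h \<in> lterm_hom L \<longrightarrow>
     (\<forall>r\<in>R. h (word_term r) = \<one>\<^bsub>L\<^esub>) \<longrightarrow> h (fst E) = h (snd E))"
proof -
  have "(\<forall>(s, t)\<in>relator_eqns R. h s = h t) \<longleftrightarrow> (\<forall>r\<in>R. h (word_term r) = \<one>\<^bsub>L\<^esub>)"
    if "h \<in> lterm_hom L" for L :: "'x lterm set lgroup" and h
  proof -
    have "(\<forall>(s, t)\<in>relator_eqns R. P s t) \<longleftrightarrow> (\<forall>r\<in>R. P (word_term r) One)" for P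
      by (auto simp: relator_eqns_def)
    moreover have "h One = \<one>\<^bsub>L\<^esub>" using that by (simp add: lterm_hom_def)
    ultimately show ?thesis by simp
  qed
  then show ?thesis unfolding lg_consequence_def by (simp cong: imp_cong)
qed

lemma (in lterm_interpretation) one_le_big_join_iff:
  assumes "ts \<noteq> []"
  shows "le \<one> (h (big_join ts)) \<longleftrightarrow> one_le_Sup L (h ` set ts)"
proof
  assume "le \<one> (h (big_join ts))"
  then show "one_le_Sup L (h ` set ts)"
    unfolding one_le_Sup_def using big_join_le_iff[OF assms] le_trans[of \<one> "h (big_join ts)"] by simp
next
  assume "one_le_Sup L (h ` set ts)"
  moreover have "\<forall>a\<in>h ` set ts. le a (h (big_join ts))"
    using big_join_le_iff[OF assms, of "h (big_join ts)"] le_refl by simp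
  ultimately show "le \<one> (h (big_join ts))" unfolding one_le_Sup_def by simp
qed

lemma lg_leq_big_join_iff:
  assumes "ts \<noteq> []"
  shows "relator_eqns R \<Turnstile>LG leq_eqn One (big_join ts) \<longleftrightarrow> one_le_Sup_valid R (set ts)"
proof -
  have "h (Meet One (big_join ts)) = h One \<longleftrightarrow> one_le_Sup L (h ` set ts)"
    if "lgroup L" "h \<in> lterm_hom L" for L :: "'a lterm set lgroup" and h
  proof -
    interpret lterm_interpretation L h
      using that by (intro lterm_interpretation.intro lterm_interpretation_axioms.intro)
    show ?thesis using one_le_big_join_iff[OF assms] by simp
  qed
  then show ?thesis
    unfolding lg_consequence_relator_eqns one_le_Sup_valid_def leq_eqn_def by (simp cong: imp_cong)
qed

text \<open>Words need not be reduced here, because the rewriting machine below collects letters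
  without cancelling.\<close>

theorem identity_iff_one_le_big_join:
  assumes R: "R \<subseteq> carrier (free_group X)" and flo: "fully_left_orderable (presented_group X R)"
    and ws: "ws \<noteq> []" "set ws \<subseteq> words X"
  shows "\<one>\<^bsub>presented_group X R\<^esub> \<in> subsemigroup_gen (presented_group X R) (word_class X R ` set ws)
    \<longleftrightarrow> relator_eqns R \<Turnstile>LG leq_eqn One (big_join (map word_term ws))"
proof
  assume one: "\<one>\<^bsub>presented_group X R\<^esub> \<in> subsemigroup_gen (presented_group X R) (word_class X R ` set ws)"
  have "one_le_Sup_valid R (word_term ` set ws)"
    unfolding one_le_Sup_valid_def image_image
    by (intro allI impI lterm_interpretation.one_le_Sup_of_subsemigroup[OF _ R _ ws(2) one]
        lterm_interpretation.intro lterm_interpretation_axioms.intro)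
  then show "relator_eqns R \<Turnstile>LG leq_eqn One (big_join (map word_term ws))"
    using lg_leq_big_join_iff[of "map word_term ws" R] ws(1) by simp
qed (rule lmeet_One_big_join_imp_subsemigroup[OF R flo ws])

subsection \<open>Recursive functions\<close>

text \<open>Since \<open>recursive_fn\<close> is about functions on lists of every length, it is not invariant under changes at
  lists of the wrong length; the following predicates are.\<close>

definition rec1 :: "(nat \<Rightarrow> nat) \<Rightarrow> bool" where
  "rec1 f \<longleftrightarrow> (\<exists>F. recursive_fn 1 F \<and> (\<forall>x. F [x] = f x))"

definition rec2 :: "(nat \<Rightarrow> nat \<Rightarrow> nat) \<Rightarrow> bool" where
  "rec2 f \<longleftrightarrow> (\<exists>F. recursive_fn 2 F \<and> (\<forall>x y. F [x, y] = f x y))"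

lemma recursive_fn_comp1: "recursive_fn 1 F \<Longrightarrow> recursive_fn n G \<Longrightarrow> recursive_fn n (\<lambda>xs. F [G xs])"
  using recursive_fn.comp[of "[G]" F n] by simp

lemma recursive_fn_comp2:
  "recursive_fn 2 F \<Longrightarrow> recursive_fn n G \<Longrightarrow> recursive_fn n H \<Longrightarrow> recursive_fn n (\<lambda>xs. F [G xs, H xs])"
  using recursive_fn.comp[of "[G, H]" F n] by (simp add: numeral_2_eq_2)

lemma rec1_id: "rec1 (\<lambda>x. x)"
  unfolding rec1_def using recursive_fn.proj[of 0 1] by (intro exI[of _ "\<lambda>xs. xs ! 0"]) simp

lemma rec1_comp:
  assumes "rec1 f" and "rec1 a"
  shows "rec1 (\<lambda>x. f (a x))"
proof -
  obtain F A where "recursive_fn 1 F" "\<forall>x. F [x] = f x" "recursive_fn 1 A" "\<forall>x. A [x] = a x"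
    using assms by (auto simp: rec1_def)
  then show ?thesis unfolding rec1_def using recursive_fn_comp1[of F 1 A]
    by (intro exI[of _ "\<lambda>xs. F [A xs]"]) simp
qed

lemma rec1_comp2:
  assumes "rec2 f" and "rec1 a" and "rec1 b"
  shows "rec1 (\<lambda>x. f (a x) (b x))"
proof -
  obtain F A B where "recursive_fn 2 F" "\<forall>x y. F [x, y] = f x y"
    "recursive_fn 1 A" "\<forall>x. A [x] = a x" "recursive_fn 1 B" "\<forall>x. B [x] = b x"
    using assms by (auto simp: rec1_def rec2_def)
  then show ?thesis unfolding rec1_def using recursive_fn_comp2[of F 1 A B]
    by (intro exI[of _ "\<lambda>xs. F [A xs, B xs]"]) simp
qed

lemma rec2_comp1:
  assumes "rec1 f" and "rec2 a"
  shows "rec2 (\<lambda>x y. f (a x y))"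
proof -
  obtain F A where "recursive_fn 1 F" "\<forall>x. F [x] = f x" "recursive_fn 2 A" "\<forall>x y. A [x, y] = a x y"
    using assms by (auto simp: rec1_def rec2_def)
  then show ?thesis unfolding rec2_def using recursive_fn_comp1[of F 2 A]
    by (intro exI[of _ "\<lambda>xs. F [A xs]"]) simp
qed

lemma rec2_comp2:
  assumes "rec2 f" and "rec2 a" and "rec2 b"
  shows "rec2 (\<lambda>x y. f (a x y) (b x y))"
proof -
  obtain F A B where "recursive_fn 2 F" "\<forall>x y. F [x, y] = f x y"
    "recursive_fn 2 A" "\<forall>x y. A [x, y] = a x y" "recursive_fn 2 B" "\<forall>x y. B [x, y] = b x y"
    using assms by (auto simp: rec2_def)
  then show ?thesis unfolding rec2_def using recursive_fn_comp2[of F 2 A B]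
    by (intro exI[of _ "\<lambda>xs. F [A xs, B xs]"]) simp
qed

lemma rec2_proj1: "rec2 (\<lambda>x y. x)"
  unfolding rec2_def using recursive_fn.proj[of 0 2] by (intro exI[of _ "\<lambda>xs. xs ! 0"]) simp

lemma rec2_proj2: "rec2 (\<lambda>x y. y)"
  unfolding rec2_def using recursive_fn.proj[of "Suc 0" 2] by (intro exI[of _ "\<lambda>xs. xs ! Suc 0"]) simp

lemmas rec2_proj = rec2_proj1 rec2_proj2

lemma rec1_Suc: "rec1 Suc"
  unfolding rec1_def using recursive_fn.succ by (intro exI[of _ "\<lambda>xs. Suc (xs ! 0)"]) simp

lemma rec1_const: "rec1 (\<lambda>x. c)"
proof (induction c)
  case 0
  show ?case unfolding rec1_def by (intro exI[of _ "\<lambda>_. 0"]) (simp add: recursive_fn.zero)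
next
  case (Suc c)
  then show ?case by (rule rec1_comp[OF rec1_Suc])
qed

text \<open>The step sees the counter and the accumulator but not the parameter; whatever an
  iteration has to remember is paired into the accumulator.\<close>

lemma rec2_rec_nat:
  assumes "rec1 a" and "rec2 s"
  shows "rec2 (\<lambda>y x. rec_nat (a x) s y)"
proof -
  obtain A S where A: "recursive_fn 1 A" "\<forall>x. A [x] = a x" and S: "recursive_fn 2 S" "\<forall>x y. S [x, y] = s x y"
    using assms by (auto simp: rec1_def rec2_def)
  have "recursive_fn (1 + 2) (\<lambda>xs. S [xs ! 0, xs ! 1])"
    by (intro recursive_fn_comp2 S recursive_fn.proj) simp_all
  from recursive_fn.prim_rec[OF A(1) this]
  show ?thesis unfolding rec2_def using A(2) S(2)
    by (intro exI[of _ "\<lambda>xs. rec_nat (A (tl xs)) (\<lambda>y r. S [(y # r # tl xs) ! 0, (y # r # tl xs) ! 1]) (hd xs)"])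
      (simp add: numeral_2_eq_2)
qed

lemma rec2_funpow: "rec1 s \<Longrightarrow> rec2 (\<lambda>y x. (s ^^ y) x)"
proof -
  assume "rec1 s"
  then have "rec2 (\<lambda>y r. s r)" by (rule rec2_comp1[OF _ rec2_proj(2)])
  from rec2_rec_nat[OF rec1_id this] have "rec2 (\<lambda>y x. rec_nat x (\<lambda>y r. s r) y)" .
  moreover have "rec_nat x (\<lambda>y r. s r) y = (s ^^ y) x" for x y by (induction y) simp_all
  ultimately show ?thesis by simp
qed

lemma rec1_funpow: "rec1 s \<Longrightarrow> rec1 a \<Longrightarrow> rec1 b \<Longrightarrow> rec1 (\<lambda>x. (s ^^ a x) (b x))"
  by (rule rec1_comp2[OF rec2_funpow])

lemma rec2_add: "rec2 (+)"
proof -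
  have "(Suc ^^ y) x = y + x" for x y by (induction y) simp_all
  then show ?thesis using rec2_funpow[OF rec1_Suc] by (simp add: fun_eq_iff eta_contract_eq)
qed

lemma rec1_pred: "rec1 (\<lambda>x. x - 1)"
proof -
  have "rec1 (\<lambda>x. rec_nat 0 (\<lambda>y r. y) x)"
    by (rule rec1_comp2[OF rec2_rec_nat[OF rec1_const rec2_proj(1)] rec1_id rec1_id])
  moreover have "rec_nat 0 (\<lambda>y r. y) x = x - 1" for x :: nat by (cases x) simp_all
  ultimately show ?thesis by simp
qed

text \<open>The arguments are reversed because \<open>rec2_funpow\<close> takes the number of
  iterations, here of the predecessor, first.\<close>

lemma rec2_diff: "rec2 (\<lambda>y x. x - y)"
proof -
  have "((\<lambda>x. x - 1) ^^ y) x = x - y" for x y :: nat by (induction y) simp_all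
  then show ?thesis using rec2_funpow[OF rec1_pred] by simp
qed

lemma rec1_triangle: "rec1 triangle"
proof -
  have "rec1 (\<lambda>x. rec_nat 0 (\<lambda>y r. r + Suc y) x)"
    by (intro rec1_comp2[OF rec2_rec_nat rec1_id rec1_id] rec1_const rec2_comp2[OF rec2_add]
        rec2_proj rec2_comp1[OF rec1_Suc])
  moreover have "rec_nat 0 (\<lambda>y r. r + Suc y) x = triangle x" for x by (induction x) simp_all
  ultimately show ?thesis by (simp add: eta_contract_eq)
qed

lemma rec1_Least:
  assumes "rec2 f" and "\<And>x. \<exists>y. f y x = 0"
  shows "rec1 (\<lambda>x. LEAST y. f y x = 0)"
proof -
  obtain F where F: "recursive_fn (1 + 1) F" "\<And>x y. F [x, y] = f x y"
    using assms(1) by (auto simp: rec2_def numeral_2_eq_2)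
  have "\<exists>y. F (y # xs) = 0" if "length xs = 1" for xs
    using that assms(2) F(2) by (cases xs) auto
  from recursive_fn.minimize[OF F(1) this] show ?thesis
    unfolding rec1_def using F(2) by (intro exI[of _ "\<lambda>xs. LEAST y. F (y # xs) = 0"]) simp
qed

lemma rec1_add: "rec1 a \<Longrightarrow> rec1 b \<Longrightarrow> rec1 (\<lambda>x. a x + b x)"
  by (rule rec1_comp2[OF rec2_add])

lemma rec1_diff: "rec1 a \<Longrightarrow> rec1 b \<Longrightarrow> rec1 (\<lambda>x. a x - b x)"
  by (rule rec1_comp2[OF rec2_diff])

lemma rec1_pair: "rec1 a \<Longrightarrow> rec1 b \<Longrightarrow> rec1 (\<lambda>x. prod_encode (a x, b x))"
  unfolding prod_encode_def prod.case by (intro rec1_add rec1_comp[OF rec1_triangle])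

section \<open>Computability of the projections of pairs\<close>

definition fstc :: "nat \<Rightarrow> nat" where "fstc n = fst (prod_decode n)"
definition sndc :: "nat \<Rightarrow> nat" where "sndc n = snd (prod_decode n)"

lemma fstc_prod_encode [simp]: "fstc (prod_encode (a, b)) = a"
  and sndc_prod_encode [simp]: "sndc (prod_encode (a, b)) = b"
  by (simp_all add: fstc_def sndc_def)

lemma triangle_mono: "m \<le> n \<Longrightarrow> triangle m \<le> triangle n"
  by (induction n rule: dec_induct) simp_all

text \<open>The code of \<open>(a, b)\<close> is \<open>triangle (a + b) + a\<close>, which lies
  below \<open>triangle (a + b + 1)\<close>. The vanishing truncated difference expresses that the
  code is less than \<open>triangle (Suc w)\<close>.\<close>

lemma triangle_root_prod_encode: "(LEAST w. Suc (prod_encode (a, b)) - triangle (Suc w) = 0) = a + b"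
proof (rule Least_equality)
  fix w assume "Suc (prod_encode (a, b)) - triangle (Suc w) = 0"
  then have "triangle (a + b) < triangle (Suc w)" by (simp add: prod_encode_def)
  then show "a + b \<le> w" using triangle_mono[of "Suc w" "a + b"] by (meson not_less not_less_eq_eq)
qed (simp add: prod_encode_def)

text \<open>Minimization finds the diagonal \<open>a + b\<close>; subtracting its triangular number
  from the code gives \<open>a\<close>, and then \<open>b\<close> is the rest of the
  diagonal.\<close>

lemma rec1_fstc_sndc: "rec1 fstc" "rec1 sndc"
proof -
  define W where "W x = (LEAST w. Suc x - triangle (Suc w) = 0)" for x
  have W: "W (prod_encode (a, b)) = a + b" for a b
    unfolding W_def by (rule triangle_root_prod_encode)
  have "rec1 W" unfolding W_def
  proof (rule rec1_Least)
    show "rec2 (\<lambda>w x. Suc x - triangle (Suc w))"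
      by (intro rec2_comp2[OF rec2_diff] rec2_comp1[OF rec1_triangle] rec2_comp1[OF rec1_Suc] rec2_proj)
    show "\<exists>w. Suc x - triangle (Suc w) = 0" for x
      by (rule exI[of _ x]) simp
  qed
  moreover have "fstc = (\<lambda>x. x - triangle (W x))"
  proof
    fix x
    obtain a b where "x = prod_encode (a, b)" by (metis prod_decode_inverse surj_pair)
    then show "fstc x = x - triangle (W x)" by (simp only: W fstc_prod_encode) (simp add: prod_encode_def)
  qed
  ultimately show fst: "rec1 fstc"
    using rec1_diff[OF rec1_id rec1_comp[OF rec1_triangle, of W]] by simp
  have "sndc = (\<lambda>x. W x - fstc x)"
  proof
    fix x
    obtain a b where "x = prod_encode (a, b)" by (metis prod_decode_inverse surj_pair)
    then show "sndc x = W x - fstc x" by (simp add: W)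
  qed
  then show "rec1 sndc" using rec1_diff[OF \<open>rec1 W\<close> fst] by simp
qed

lemma rec1_fstc: "rec1 a \<Longrightarrow> rec1 (\<lambda>x. fstc (a x))"
  and rec1_sndc: "rec1 a \<Longrightarrow> rec1 (\<lambda>x. sndc (a x))"
  by (rule rec1_comp[OF rec1_fstc_sndc(1)], assumption) (rule rec1_comp[OF rec1_fstc_sndc(2)])

text \<open>A conditional is an iteration on a pair whose second component overwrites the first.\<close>

lemma rec1_if0:
  assumes "rec1 c" and "rec1 a" and "rec1 b"
  shows "rec1 (\<lambda>x. if c x = 0 then a x else b x)"
proof -
  define s where "s p = prod_encode (sndc p, sndc p)" for p
  have "rec1 (\<lambda>x. fstc ((s ^^ c x) (prod_encode (a x, b x))))"
    unfolding s_def by (intro rec1_fstc rec1_funpow rec1_pair rec1_sndc rec1_id assms)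
  moreover have "fstc ((s ^^ n) (prod_encode (u, v))) = (if n = 0 then u else v)" for n u v
  proof -
    have "(s ^^ Suc n) (prod_encode (u, v)) = prod_encode (v, v)" for n
      by (induction n) (simp_all add: s_def)
    then show ?thesis by (cases n) simp_all
  qed
  ultimately show ?thesis by simp
qed

lemma rec1_if_eq:
  assumes "rec1 c" and "rec1 d" and "rec1 a" and "rec1 b"
  shows "rec1 (\<lambda>x. if c x = d x then a x else b x)"
proof -
  have "rec1 (\<lambda>x. if (c x - d x) + (d x - c x) = 0 then a x else b x)"
    by (intro rec1_if0 rec1_add rec1_diff assms)
  moreover have "(m - n) + (n - m) = 0 \<longleftrightarrow> m = n" for m n :: nat by auto
  ultimately show ?thesis by simp
qed

section \<open>Lists coded as numbers, and folds over them\<close>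

definition hdc :: "nat \<Rightarrow> nat" where "hdc n = fstc (n - 1)"
definition tlc :: "nat \<Rightarrow> nat" where "tlc n = sndc (n - 1)"
definition consc :: "nat \<Rightarrow> nat \<Rightarrow> nat" where "consc a n = Suc (prod_encode (a, n))"

lemma consc_simps [simp]: "hdc (consc a n) = a" "tlc (consc a n) = n" "consc a n \<noteq> 0"
  by (simp_all add: hdc_def tlc_def consc_def)

declare list_encode.simps(2) [simp del]

text \<open>Replaces the deleted equation so that codes of nonempty lists stay in a form on which
  \<open>hdc\<close> and \<open>tlc\<close> simplify.\<close>

lemma list_encode_consc [simp]: "list_encode (x # xs) = consc x (list_encode xs)"
  by (simp add: consc_def list_encode.simps(2))

lemma rec1_consc: "rec1 a \<Longrightarrow> rec1 b \<Longrightarrow> rec1 (\<lambda>x. consc (a x) (b x))"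
  unfolding consc_def by (intro rec1_comp[OF rec1_Suc] rec1_pair)

lemma rec1_hdc: "rec1 a \<Longrightarrow> rec1 (\<lambda>x. hdc (a x))"
  and rec1_tlc: "rec1 a \<Longrightarrow> rec1 (\<lambda>x. tlc (a x))"
  unfolding hdc_def tlc_def by (intro rec1_fstc rec1_sndc rec1_diff rec1_const; assumption)+

lemma rec1_power3:
  assumes "rec1 a" shows "rec1 (\<lambda>x. 3 ^ a x)"
proof -
  have "((\<lambda>y. y + (y + y)) ^^ n) 1 = (3 :: nat) ^ n" for n by (induction n) simp_all
  moreover have "rec1 (\<lambda>x. ((\<lambda>y. y + (y + y)) ^^ a x) 1)"
    by (intro rec1_funpow rec1_add rec1_id rec1_const assms)
  ultimately show ?thesis by simp
qed

lemmas rec1_intros = rec1_id rec1_const rec1_add rec1_diff rec1_pair rec1_fstc rec1_sndc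
  rec1_if_eq rec1_consc rec1_hdc rec1_tlc rec1_power3 rec1_funpow

lemma decidable_problem_iff_rec1:
  "decidable_problem code I P \<longleftrightarrow> (\<exists>f. rec1 f \<and> (\<forall>i\<in>I. f (code i) = (if P i then 1 else 0)))"
proof
  assume "decidable_problem code I P"
  then obtain F where "recursive_fn 1 F" "\<forall>i\<in>I. F [code i] = (if P i then 1 else 0)"
    by (auto simp: decidable_problem_def)
  then show "\<exists>f. rec1 f \<and> (\<forall>i\<in>I. f (code i) = (if P i then 1 else 0))"
    by (intro exI[of _ "\<lambda>x. F [x]"]) (auto simp: rec1_def)
qed (auto simp: decidable_problem_def rec1_def)

text \<open>A left fold whose state pairs the accumulator with the remaining list. The list code
  itself serves as the number of iterations: it bounds the length, and surplus iterations are
  idle.\<close>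

definition foldc :: "(nat \<Rightarrow> nat) \<Rightarrow> nat \<Rightarrow> nat \<Rightarrow> nat" where
  "foldc s a n = fstc (((\<lambda>p. if sndc p = 0 then p
     else prod_encode (s (prod_encode (fstc p, hdc (sndc p))), tlc (sndc p))) ^^ n) (prod_encode (a, n)))"

lemma rec1_foldc:
  assumes "rec1 s" and "rec1 a" and "rec1 b"
  shows "rec1 (\<lambda>x. foldc s (a x) (b x))"
  unfolding foldc_def by (intro rec1_intros rec1_comp[OF assms(1)] assms(2,3))

lemma length_le_list_encode: "length xs \<le> list_encode xs"
proof (induction xs)
  case (Cons x xs)
  then show ?case using le_prod_encode_2[of "list_encode xs" x] by (simp add: consc_def)
qed simp

lemma foldc_list_encode:
  "foldc s a (list_encode xs) = foldl (\<lambda>acc x. s (prod_encode (acc, x))) a xs"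
proof -
  define t where "t p = (if sndc p = 0 then p
     else prod_encode (s (prod_encode (fstc p, hdc (sndc p))), tlc (sndc p)))" for p
  have "(t ^^ n) (prod_encode (a, list_encode xs)) =
      prod_encode (foldl (\<lambda>acc x. s (prod_encode (acc, x))) a xs, 0)" if "length xs \<le> n" for n
    using that
  proof (induction n arbitrary: a xs)
    case (Suc n)
    have t: "t (prod_encode (b, 0)) = prod_encode (b, 0)" for b by (simp add: t_def)
    show ?case
    proof (cases xs)
      case Nil
      then show ?thesis using Suc.IH[of "[]" a] by (simp add: t)
    next
      case (Cons x ys)
      then have "t (prod_encode (a, list_encode xs)) = prod_encode (s (prod_encode (a, x)), list_encode ys)"
        by (simp add: t_def)
      then show ?thesis using Suc Cons by (simp add: funpow_swap1)
    qed
  qed simp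
  from this[OF length_le_list_encode] show ?thesis unfolding foldc_def t_def[symmetric] by simp
qed

subsection \<open>A rewriting machine for inequalities between terms\<close>

text \<open>
  A state is a conjunction of goals \<open>e \<le> \<dots> \<squnion> \<dots>\<close>. The joinands of a goal \<open>(ds, ps)\<close> are the group words
  \<open>ds\<close> and the products \<open>ps\<close>, where \<open>(w, [t\<^sub>1, \<dots>, t\<^sub>k])\<close> stands for \<open>t\<^sub>k \<cdots> t\<^sub>1 w\<close>. A step splits the term next
  to \<open>w\<close>; a goal without unfinished products is handed to the oracle \<open>J\<close>, and the machine gets stuck
  if \<open>J\<close> rejects it.
\<close>

type_synonym 'x goal = "'x word list \<times> ('x word \<times> 'x lterm list) list"

fun step :: "('x word list \<Rightarrow> bool) \<Rightarrow> 'x goal list \<Rightarrow> 'x goal list" where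
  "step J [] = []"
| "step J ((ds, []) # gs) = (if J ds then gs else (ds, []) # gs)"
| "step J ((ds, (w, []) # ps) # gs) = (w # ds, ps) # gs"
| "step J ((ds, (w, Var x # ts) # ps) # gs) = (ds, ((x, True) # w, ts) # ps) # gs"
| "step J ((ds, (w, One # ts) # ps) # gs) = (ds, (w, ts) # ps) # gs"
| "step J ((ds, (w, Mul s t # ts) # ps) # gs) = (ds, (w, t # s # ts) # ps) # gs"
| "step J ((ds, (w, Meet s t # ts) # ps) # gs) = (ds, (w, s # ts) # ps) # (ds, (w, t # ts) # ps) # gs"
| "step J ((ds, (w, Join s t # ts) # ps) # gs) = (ds, (w, s # ts) # (w, t # ts) # ps) # gs"
| "step J ((ds, (w, Inv (Var x) # ts) # ps) # gs) = (ds, ((x, False) # w, ts) # ps) # gs"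
| "step J ((ds, (w, Inv One # ts) # ps) # gs) = (ds, (w, ts) # ps) # gs"
| "step J ((ds, (w, Inv (Inv s) # ts) # ps) # gs) = (ds, (w, s # ts) # ps) # gs"
| "step J ((ds, (w, Inv (Mul s t) # ts) # ps) # gs) = (ds, (w, Inv s # Inv t # ts) # ps) # gs"
| "step J ((ds, (w, Inv (Meet s t) # ts) # ps) # gs) = (ds, (w, Inv s # ts) # (w, Inv t # ts) # ps) # gs"
| "step J ((ds, (w, Inv (Join s t) # ts) # ps) # gs) =
    (ds, (w, Inv s # ts) # ps) # (ds, (w, Inv t # ts) # ps) # gs"

fun product_term :: "'x word \<times> 'x lterm list \<Rightarrow> 'x lterm" where
  "product_term (w, ts) = Mul (foldr (\<lambda>t u. Mul u t) ts One) (word_term w)"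

fun goal_terms :: "'x goal \<Rightarrow> 'x lterm set" where
  "goal_terms (ds, ps) = word_term ` set ds \<union> product_term ` set ps"

definition state_valid :: "'x word set \<Rightarrow> 'x goal list \<Rightarrow> bool" where
  "state_valid R gs \<longleftrightarrow> (\<forall>g\<in>set gs. one_le_Sup_valid R (goal_terms g))"

text \<open>The last conjunct guarantees a joinand, since the oracle is assumed correct only on
  nonempty lists.\<close>

definition goal_wf :: "'x set \<Rightarrow> 'x goal \<Rightarrow> bool" where
  "goal_wf X = (\<lambda>(ds, ps). set ds \<subseteq> words X \<and> (\<forall>(w, ts)\<in>set ps. w \<in> words X \<and> set ts \<subseteq> lterms X) \<and>
     (ds \<noteq> [] \<or> ps \<noteq> []))"

lemma step_wf: "\<forall>g\<in>set gs. goal_wf X g \<Longrightarrow> \<forall>g\<in>set (step J gs). goal_wf X g"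
  by (cases "(J, gs)" rule: step.cases) (auto simp: goal_wf_def lterms_def)

lemma (in lterm_interpretation) one_le_Sup_insert_ljoin:
  assumes "A \<subseteq> carrier L" "a \<in> carrier L" "b \<in> carrier L"
  shows "one_le_Sup L (insert (ljoin L a b) A) \<longleftrightarrow> one_le_Sup L (insert a (insert b A))"
  unfolding one_le_Sup_def using ljoin_le_iff[OF assms(2,3)] by blast

text \<open>From right to left this is distributivity: if \<open>z\<close> bounds \<open>A\<close>
  and the meet, then the joins of \<open>z\<close> with \<open>a\<close> and with \<open>b\<close>
  are both above the identity, and their meet is \<open>z\<close>.\<close>

lemma (in lterm_interpretation) one_le_Sup_insert_lmeet:
  assumes A: "A \<subseteq> carrier L" and a: "a \<in> carrier L" and b: "b \<in> carrier L"
  shows "one_le_Sup L (insert (lmeet L a b) A) \<longleftrightarrow> one_le_Sup L (insert a A) \<and> one_le_Sup L (insert b A)"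
proof
  assume l: "one_le_Sup L (insert (lmeet L a b) A)"
  have "le (lmeet L a b) z" if "le a z \<or> le b z" "z \<in> carrier L" for z
    using that a b le_lmeet_iff[of a b "lmeet L a b"] le_refl[of "lmeet L a b"] lmeet_closed[OF a b]
    by (meson le_trans)
  then show "one_le_Sup L (insert a A) \<and> one_le_Sup L (insert b A)"
    using l unfolding one_le_Sup_def by (simp add: ball_simps)
next
  assume r: "one_le_Sup L (insert a A) \<and> one_le_Sup L (insert b A)"
  show "one_le_Sup L (insert (lmeet L a b) A)"
    unfolding one_le_Sup_def
  proof (intro ballI impI)
    fix z assume z: "z \<in> carrier L" and ub: "\<forall>u\<in>insert (lmeet L a b) A. le u z"
    have one: "le \<one> (ljoin L z x)" if x: "x \<in> {a, b}" for x
    proof -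
      have xc: "x \<in> carrier L" using x a b by auto
      have j: "le z (ljoin L z x)" "le x (ljoin L z x)"
        using ljoin_le_iff[OF z xc ljoin_closed[OF z xc]] le_refl[OF ljoin_closed[OF z xc]] by auto
      have "le u (ljoin L z x)" if "u \<in> insert x A" for u
      proof (cases "u = x")
        case False
        then have "u \<in> A" using that by simp
        then show ?thesis using ub A z xc by (intro le_trans[OF _ j(1)]) (auto simp: ljoin_closed)
      qed (simp add: j)
      then show ?thesis using r x ljoin_closed[OF z xc] unfolding one_le_Sup_def by blast
    qed
    have "le \<one> (lmeet L (ljoin L z a) (ljoin L z b))"
      using one a b z by (simp add: le_lmeet_iff ljoin_closed)
    then show "le \<one> z" using lmeet_ljoin_le[OF a b z] ub by simp
  qed
qed

text \<open>These are the identities behind the rules of \<open>step\<close>. The head of the list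
  is the factor next to \<open>w\<close>, hence \<open>t\<close> before \<open>s\<close> for
  \<open>Mul s t\<close>, and the opposite order under an inverse.\<close>

lemma (in lterm_interpretation) product_term_step:
  "h (product_term (w, Var x # ts)) = h (product_term ((x, True) # w, ts))"
  "h (product_term (w, One # ts)) = h (product_term (w, ts))"
  "h (product_term (w, Mul s t # ts)) = h (product_term (w, t # s # ts))"
  "h (product_term (w, Meet s t # ts)) = lmeet L (h (product_term (w, s # ts))) (h (product_term (w, t # ts)))"
  "h (product_term (w, Join s t # ts)) = ljoin L (h (product_term (w, s # ts))) (h (product_term (w, t # ts)))"
  "h (product_term (w, Inv (Var x) # ts)) = h (product_term ((x, False) # w, ts))"
  "h (product_term (w, Inv One # ts)) = h (product_term (w, ts))"
  "h (product_term (w, Inv (Inv s) # ts)) = h (product_term (w, s # ts))"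
  "h (product_term (w, Inv (Mul s t) # ts)) = h (product_term (w, Inv s # Inv t # ts))"
  "h (product_term (w, Inv (Meet s t) # ts)) =
    ljoin L (h (product_term (w, Inv s # ts))) (h (product_term (w, Inv t # ts)))"
  "h (product_term (w, Inv (Join s t) # ts)) =
    lmeet L (h (product_term (w, Inv s # ts))) (h (product_term (w, Inv t # ts)))"
  "h (product_term (w, [])) = h (word_term w)"
  by (simp_all add: m_assoc inv_mult_group inv_lmeet inv_ljoin mult_lmeet_distrib mult_ljoin_distrib)

lemma (in lterm_interpretation) one_le_Sup_step:
  assumes "\<And>ds gs'. gs \<noteq> (ds, []) # gs'"
  shows "(\<forall>g\<in>set (step J gs). one_le_Sup L (h ` goal_terms g)) \<longleftrightarrow>
    (\<forall>g\<in>set gs. one_le_Sup L (h ` goal_terms g))"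
proof -
  have c: "h ` T \<subseteq> carrier L" for T by auto
  show ?thesis
    using assms
    by (cases "(J, gs)" rule: step.cases)
      (simp_all add: image_Un product_term_step one_le_Sup_insert_ljoin one_le_Sup_insert_lmeet c
        del: product_term.simps)
qed

lemma state_valid_step:
  fixes R :: "'x word set"
  assumes "\<And>ds gs'. gs \<noteq> (ds, []) # gs'"
  shows "state_valid R (step J gs) \<longleftrightarrow> state_valid R gs"
proof -
  have "(\<forall>g\<in>set (step J gs). one_le_Sup L (h ` goal_terms g)) \<longleftrightarrow>
      (\<forall>g\<in>set gs. one_le_Sup L (h ` goal_terms g))"
    if "lgroup L" "h \<in> lterm_hom L" for L :: "'x lterm set lgroup" and h
    using that assms
    by (intro lterm_interpretation.one_le_Sup_step lterm_interpretation.intro lterm_interpretation_axioms.intro)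
  then show ?thesis unfolding state_valid_def one_le_Sup_valid_def by blast
qed

section \<open>Termination of the machine\<close>

primrec lterm_weight :: "'x lterm \<Rightarrow> nat" where
  "lterm_weight (Var x) = 2"
| "lterm_weight One = 2"
| "lterm_weight (Inv s) = lterm_weight s * lterm_weight s"
| "lterm_weight (Mul s t) = lterm_weight s * lterm_weight t + 1"
| "lterm_weight (Meet s t) = lterm_weight s + lterm_weight t + 1"
| "lterm_weight (Join s t) = lterm_weight s + lterm_weight t + 1"

lemma lterm_weight_ge_2: "lterm_weight t \<ge> 2"
proof (induction t)
  case (Inv s)
  then show ?case using mult_le_mono[of 2 "lterm_weight s" 2 "lterm_weight s"] by simp
next
  case (Mul s t)
  then show ?case using mult_le_mono[of 2 "lterm_weight s" 2 "lterm_weight t"] by simp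
qed simp_all

abbreviation product_weight :: "'x lterm list \<Rightarrow> nat" where
  "product_weight ts \<equiv> prod_list (map lterm_weight ts)"

text \<open>Splitting a meet copies the whole goal; the exponential lets a drop in the exponent pay
  for both copies. A goal without unfinished products still weighs 1, so discarding it also
  counts.\<close>

definition goal_weight :: "'x goal \<Rightarrow> nat" where
  "goal_weight g = 3 ^ (\<Sum>(w, ts)\<leftarrow>snd g. product_weight ts)"

definition state_weight :: "'x goal list \<Rightarrow> nat" where
  "state_weight gs = (\<Sum>g\<leftarrow>gs. goal_weight g)"

lemma product_weight_pos: "product_weight ts > 0"
proof (induction ts)
  case (Cons t ts)
  then show ?case using lterm_weight_ge_2[of t] by simp
qed simp

text \<open>Both exponents on the left are at most \<open>m = p + q + s\<close>, and
  \<open>2 * 3 ^ m < 3 ^ (m + 1)\<close>.\<close>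

lemma power3_add_less:
  fixes p q r s :: nat
  assumes "p + q < r"
  shows "3 ^ (p + s) + 3 ^ (q + s) < (3 :: nat) ^ (r + s)"
proof -
  have "(3::nat) ^ (p + s) \<le> 3 ^ (p + q + s)" "(3::nat) ^ (q + s) \<le> 3 ^ (p + q + s)"
    by (rule power_increasing; simp)+
  moreover have "(3::nat) ^ Suc (p + q + s) \<le> 3 ^ (r + s)"
    using assms by (intro power_increasing) simp_all
  moreover have "(0::nat) < 3 ^ (p + q + s)" by simp
  ultimately show ?thesis unfolding power_Suc by linarith
qed

text \<open>Multiplying weights along a product matches distributivity, which splits one factor and
  keeps the others. Squaring under \<open>Inv\<close> pays for pushing the inverse inwards:
  \<open>(a + b + 1)^2\<close> exceeds \<open>a^2 + b^2\<close>, and \<open>(a * b + 1)^2\<close>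
  exceeds \<open>a^2 * b^2\<close>. As weights are at least 2, removing a factor also
  decreases.\<close>

lemma state_weight_step:
  assumes "gs \<noteq> []" and "\<And>ds gs'. gs = (ds, []) # gs' \<Longrightarrow> J ds"
  shows "state_weight (step J gs) < state_weight gs"
proof -
  have pw: "0 < product_weight ts" for ts :: "'a lterm list" by (rule product_weight_pos)
  have w2: "1 < lterm_weight t" for t :: "'a lterm" using lterm_weight_ge_2[of t] by simp
  have inv2: "lterm_weight s < lterm_weight s * lterm_weight s * (lterm_weight s * lterm_weight s)" for s :: "'a lterm"
  proof -
    have "lterm_weight s * 1 < lterm_weight s * (lterm_weight s * (lterm_weight s * lterm_weight s))"
      using w2[of s] by (intro mult_strict_left_mono less_1_mult) simp_all
    then show ?thesis by (simp add: mult.assoc)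
  qed
  have decr: "a * product_weight ts < b * product_weight ts" if "a < b" for a b and ts :: "'a lterm list"
    using that pw[of ts] by simp
  have split: "a * product_weight ts + b * product_weight ts < c * product_weight ts" if "a + b < c"
    for a b c and ts :: "'a lterm list"
    using decr[OF that, of ts] by (simp add: distrib_right)
  note weight = state_weight_def goal_weight_def
  show ?thesis
    using assms(2)
  proof (cases "(J, gs)" rule: step.cases)
    case (4 J' ds w x ts ps gs')
    then show ?thesis using decr[of 1 2 ts] by (simp add: weight)
  next
    case (5 J' ds w ts ps gs')
    then show ?thesis using decr[of 1 2 ts] by (simp add: weight)
  next
    case (6 J' ds w s t ts ps gs')
    then show ?thesis
      using decr[of "lterm_weight t * lterm_weight s" "lterm_weight s * lterm_weight t + 1" ts]
      by (simp add: weight mult.assoc)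
  next
    case (7 J' ds w s t ts ps gs')
    then show ?thesis
      using power3_add_less[OF split, of "lterm_weight s" "lterm_weight t" "lterm_weight (Meet s t)" ts
          "\<Sum>(w, ts)\<leftarrow>ps. product_weight ts"]
      by (simp add: weight)
  next
    case (8 J' ds w s t ts ps gs')
    then show ?thesis using split[of "lterm_weight s" "lterm_weight t" "lterm_weight (Join s t)" ts]
      by (simp add: weight)
  next
    case (9 J' ds w x ts ps gs')
    then show ?thesis using decr[of 1 4 ts] by (simp add: weight)
  next
    case (10 J' ds w ts ps gs')
    then show ?thesis using decr[of 1 4 ts] by (simp add: weight)
  next
    case (11 J' ds w s ts ps gs')
    then show ?thesis using decr[OF inv2[of s]] by (simp add: weight)
  next
    case (12 J' ds w s t ts ps gs')
    have "lterm_weight (Inv s) * lterm_weight (Inv t) < lterm_weight (Inv (Mul s t))"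
      by (simp add: algebra_simps)
    from decr[OF this] show ?thesis using 12 by (simp add: weight mult.assoc)
  next
    case (13 J' ds w s t ts ps gs')
    have "lterm_weight (Inv s) + lterm_weight (Inv t) < lterm_weight (Inv (Meet s t))"
      by (simp add: algebra_simps)
    from split[OF this] show ?thesis using 13 by (simp add: weight)
  next
    case (14 J' ds w s t ts ps gs')
    have "lterm_weight (Inv s) + lterm_weight (Inv t) < lterm_weight (Inv (Join s t))"
      by (simp add: algebra_simps)
    from power3_add_less[OF split[OF this]] show ?thesis using 14 by (simp add: weight)
  qed (use assms(1) in \<open>simp_all add: weight\<close>)
qed

text \<open>Each step lowers the weight unless the state is empty or headed by a rejected goal, so
  the initial weight bounds the number of effective steps.\<close>

lemma step_funpow_stuck:
  assumes "state_weight gs \<le> n"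
  shows "step J ((step J ^^ n) gs) = (step J ^^ n) gs"
  using assms
proof (induction n arbitrary: gs)
  case 0
  then have "gs = [] \<or> (\<exists>ds gs'. gs = (ds, []) # gs' \<and> \<not> J ds)"
    using state_weight_step[of gs J] by fastforce
  then show ?case by auto
next
  case (Suc n)
  show ?case
  proof (cases "step J gs = gs")
    case True
    then have "(step J ^^ k) gs = gs" for k by (induction k) simp_all
    then show ?thesis using True by metis
  next
    case False
    then have "gs \<noteq> []" "\<And>ds gs'. gs = (ds, []) # gs' \<Longrightarrow> J ds" by (auto split: if_splits)
    then have "state_weight (step J gs) \<le> n" using state_weight_step[of gs J] Suc.prems by simp
    then show ?thesis using Suc.IH by (simp add: funpow_swap1)
  qed
qed

text \<open>Every step preserves validity, as the oracle discards only valid goals. After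
  \<open>n\<close> steps the state is a fixed point, and a nonempty one begins with a rejected,
  hence invalid, goal.\<close>

lemma machine_correct:
  assumes J: "\<And>ds. ds \<noteq> [] \<Longrightarrow> set ds \<subseteq> words X \<Longrightarrow> J ds \<longleftrightarrow> one_le_Sup_valid R (word_term ` set ds)"
    and wf: "\<forall>g\<in>set gs. goal_wf X g" and n: "state_weight gs \<le> n"
  shows "(step J ^^ n) gs = [] \<longleftrightarrow> state_valid R gs"
proof -
  have J_goal: "J ds \<longleftrightarrow> one_le_Sup_valid R (goal_terms (ds, []))" if "goal_wf X (ds, [])" for ds
    using J[of ds] that by (simp add: goal_wf_def)
  have val: "state_valid R (step J gs) \<longleftrightarrow> state_valid R gs" if "\<forall>g\<in>set gs. goal_wf X g" for gs
  proof (cases "\<exists>ds gs'. gs = (ds, []) # gs'")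
    case True
    then obtain ds gs' where gs: "gs = (ds, []) # gs'" by blast
    then show ?thesis using J_goal[of ds] that by (cases "J ds") (simp_all add: state_valid_def)
  next
    case False
    then show ?thesis by (intro state_valid_step) blast
  qed
  have inv: "(\<forall>g\<in>set ((step J ^^ k) gs). goal_wf X g) \<and>
      (state_valid R ((step J ^^ k) gs) \<longleftrightarrow> state_valid R gs)" for k
  proof (induction k)
    case (Suc k)
    then show ?case using step_wf[of "(step J ^^ k) gs" X J] val[of "(step J ^^ k) gs"] by simp
  qed (use wf in simp)
  define q where "q = (step J ^^ n) gs"
  have q: "step J q = q" unfolding q_def using n by (rule step_funpow_stuck)
  have "q = [] \<longleftrightarrow> state_valid R q"
  proof (cases "q = []")
    case False
    then obtain ds gs' where "q = (ds, []) # gs'" "\<not> J ds"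
      using state_weight_step[of q J] q by auto
    then show ?thesis using J_goal[of ds] inv[of n] by (auto simp: q_def state_valid_def)
  qed (simp add: state_valid_def)
  then show ?thesis using inv[of n] by (simp add: q_def)
qed

section \<open>The machine on codes\<close>

definition state_code :: "('x \<Rightarrow> nat) \<Rightarrow> 'x goal list \<Rightarrow> nat" where
  "state_code \<nu> gs = list_encode (map (\<lambda>(ds, ps). prod_encode (list_encode (map (word_code \<nu>) ds),
     list_encode (map (\<lambda>(w, ts). prod_encode (word_code \<nu> w, list_encode (map (lterm_code \<nu>) ts))) ps))) gs)"

text \<open>Here \<open>c\<close> is the tag of the leading term. The tests from
  \<open>s = 0\<close> on treat the remaining tag 2, an inverse, for which \<open>s\<close> and
  \<open>t\<close> are tag and body of the inverted term instead of two subterms.\<close>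

definition stepc :: "(nat \<Rightarrow> nat) \<Rightarrow> nat \<Rightarrow> nat" where
  "stepc f n =
    (let gs = tlc n; ds = fstc (hdc n); ps = sndc (hdc n);
       w = fstc (hdc ps); ts = sndc (hdc ps); qs = tlc ps;
       c = fstc (hdc ts); a = sndc (hdc ts); us = tlc ts; s = fstc a; t = sndc a;
       s' = fstc t; t' = sndc t;
       goal = (\<lambda>ps'. prod_encode (ds, ps'));
       product = (\<lambda>w' ts'. prod_encode (w', ts'));
       push = (\<lambda>ts'. consc (goal (consc (product w ts') qs)) gs)
     in if n = 0 then 0
        else if ps = 0 then (if f ds = 1 then gs else n)
        else if ts = 0 then consc (prod_encode (consc w ds, qs)) gs
        else if c = 0 then consc (goal (consc (product (consc (prod_encode (a, 1)) w) us) qs)) gs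
        else if c = 1 then push us
        else if c = 3 then push (consc t (consc s us))
        else if c = 4 then consc (goal (consc (product w (consc s us)) qs)) (push (consc t us))
        else if c = 5 then consc (goal (consc (product w (consc s us)) (consc (product w (consc t us)) qs))) gs
        else if s = 0 then consc (goal (consc (product (consc (prod_encode (t, 0)) w) us) qs)) gs
        else if s = 1 then push us
        else if s = 2 then push (consc t us)
        else if s = 3 then push (consc (prod_encode (2, s')) (consc (prod_encode (2, t')) us))
        else if s = 4 then consc (goal (consc (product w (consc (prod_encode (2, s')) us))
          (consc (product w (consc (prod_encode (2, t')) us)) qs))) gs
        else consc (goal (consc (product w (consc (prod_encode (2, s')) us)) qs))
          (push (consc (prod_encode (2, t')) us)))"

lemma rec1_stepc:
  assumes "rec1 f"
  shows "rec1 (stepc f)"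
  unfolding stepc_def Let_def by (intro rec1_intros rec1_comp[OF assms])

lemma stepc_state_code:
  assumes "\<And>ds gs'. gs = (ds, []) # gs' \<Longrightarrow> f (list_encode (map (word_code \<nu>) ds)) = (if J ds then 1 else 0)"
  shows "stepc f (state_code \<nu> gs) = state_code \<nu> (step J gs)"
  using assms
  by (cases "(J, gs)" rule: step.cases) (simp_all add: stepc_def state_code_def word_code_def Let_def)

lemma funpow_stepc_state_code:
  assumes f: "\<And>ds. ds \<in> lists (words X) \<Longrightarrow> f (list_encode (map (word_code \<nu>) ds)) = (if J ds then 1 else 0)"
    and wf: "\<forall>g\<in>set gs. goal_wf X g"
  shows "(stepc f ^^ n) (state_code \<nu> gs) = state_code \<nu> ((step J ^^ n) gs)"
  using wf
proof (induction n arbitrary: gs)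
  case (Suc n)
  have "stepc f (state_code \<nu> gs) = state_code \<nu> (step J gs)"
    using Suc.prems by (intro stepc_state_code f) (auto simp: goal_wf_def)
  then show ?case using Suc.IH[OF step_wf[OF Suc.prems]] by (simp add: funpow_swap1)
qed simp

lemma state_code_eq_0_iff: "state_code \<nu> gs = 0 \<longleftrightarrow> gs = []"
  by (cases gs) (simp_all add: state_code_def)

section \<open>A computable bound on the running time\<close>

lemma prod_encode_bounds:
  "a + b \<le> prod_encode (a, b)" "a + b + 6 \<le> prod_encode (3, prod_encode (a, b))"
  "a + b + 6 \<le> prod_encode (4, prod_encode (a, b))" "a + b + 6 \<le> prod_encode (5, prod_encode (a, b))"
  "2 * a + 2 \<le> prod_encode (2, a)"
proof -
  have le: "n \<le> triangle n" for n by (induction n) simp_all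
  have le2: "2 * n \<le> triangle (Suc (Suc n))" for n by (induction n) simp_all
  show ab: "a + b \<le> prod_encode (a, b)" using le[of "a + b"] by (simp add: prod_encode_def)
  show "2 * a + 2 \<le> prod_encode (2, a)" using le2[of a] by (simp add: prod_encode_def)
  have big: "z + 6 \<le> prod_encode (k, z)" if "k \<ge> 3" for k z
  proof -
    have "z + 6 \<le> triangle (Suc (Suc (Suc z))) + 3" using le[of z] by simp
    also have "\<dots> \<le> triangle (k + z) + k" using that by (intro add_mono triangle_mono) simp_all
    finally show ?thesis by (simp add: prod_encode_def)
  qed
  show "a + b + 6 \<le> prod_encode (3, prod_encode (a, b))"
    using big[of 3 "prod_encode (a, b)"] ab by linarith
  show "a + b + 6 \<le> prod_encode (4, prod_encode (a, b))"
    using big[of 4 "prod_encode (a, b)"] ab by linarith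
  show "a + b + 6 \<le> prod_encode (5, prod_encode (a, b))"
    using big[of 5 "prod_encode (a, b)"] ab by linarith
qed

lemma power3_sum_le: "3 ^ Suc a + 3 ^ Suc b + 1 \<le> (3 :: nat) ^ (a + b + 3)"
proof -
  have "(3::nat) ^ Suc a \<le> 3 ^ (a + b + 1)" "(3::nat) ^ Suc b \<le> 3 ^ (a + b + 1)" "(1::nat) \<le> 3 ^ (a + b + 1)"
    by (simp_all add: power_increasing del: power_Suc)
  moreover have "(3::nat) ^ (a + b + 3) = 9 * 3 ^ (a + b + 1)" by (simp add: power_add)
  ultimately show ?thesis by linarith
qed

text \<open>The tags leave enough room in the code of a compound term to absorb the constants in its
  weight. The bound makes a sufficient number of steps computable from the code.\<close>

lemma lterm_weight_le_code: "lterm_weight t \<le> 3 ^ Suc (lterm_code \<nu> t)"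
proof (induction t)

  case (Var x)
  show ?case unfolding lterm_weight.simps by (rule order_trans[OF _ power_increasing[of 1]]) simp_all
next
  case One
  show ?case unfolding lterm_weight.simps by (rule order_trans[OF _ power_increasing[of 1]]) simp_all
next
  case (Inv s)
  have "lterm_weight (Inv s) \<le> 3 ^ Suc (lterm_code \<nu> s) * 3 ^ Suc (lterm_code \<nu> s)"
    using mult_le_mono[OF Inv Inv] by simp
  also have "\<dots> = 3 ^ (2 * lterm_code \<nu> s + 2)" by (simp add: mult_2 power_add)
  also have "\<dots> \<le> 3 ^ Suc (lterm_code \<nu> (Inv s))"
    using prod_encode_bounds(5)[of "lterm_code \<nu> s"] by (intro power_increasing) simp_all
  finally show ?case .
next
  case (Mul s t)
  have "lterm_weight (Mul s t) \<le> 3 ^ Suc (lterm_code \<nu> s) * 3 ^ Suc (lterm_code \<nu> t) + 1"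
    using mult_le_mono[OF Mul] by simp
  also have "\<dots> \<le> 3 ^ (lterm_code \<nu> s + lterm_code \<nu> t + 3)"
  proof -
    have "(1::nat) \<le> 3 ^ (lterm_code \<nu> s + lterm_code \<nu> t)" by simp
    moreover have "(3::nat) ^ (lterm_code \<nu> s + lterm_code \<nu> t + 3) = 27 * 3 ^ (lterm_code \<nu> s + lterm_code \<nu> t)"
      "(3::nat) ^ Suc (lterm_code \<nu> s) * 3 ^ Suc (lterm_code \<nu> t) = 9 * 3 ^ (lterm_code \<nu> s + lterm_code \<nu> t)"
      by (simp_all add: power_add)
    ultimately show ?thesis by linarith
  qed
  also have "\<dots> \<le> 3 ^ Suc (lterm_code \<nu> (Mul s t))"
    using prod_encode_bounds(2)[of "lterm_code \<nu> s" "lterm_code \<nu> t"] by (intro power_increasing) simp_all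
  finally show ?case .
next
  case (Meet s t)
  have "lterm_weight (Meet s t) \<le> 3 ^ Suc (lterm_code \<nu> s) + 3 ^ Suc (lterm_code \<nu> t) + 1"
    using Meet by simp
  also have "\<dots> \<le> 3 ^ (lterm_code \<nu> s + lterm_code \<nu> t + 3)" by (rule power3_sum_le)
  also have "\<dots> \<le> 3 ^ Suc (lterm_code \<nu> (Meet s t))"
    using prod_encode_bounds(3)[of "lterm_code \<nu> s" "lterm_code \<nu> t"] by (intro power_increasing) simp_all
  finally show ?case .
next
  case (Join s t)
  have "lterm_weight (Join s t) \<le> 3 ^ Suc (lterm_code \<nu> s) + 3 ^ Suc (lterm_code \<nu> t) + 1"
    using Join by simp
  also have "\<dots> \<le> 3 ^ (lterm_code \<nu> s + lterm_code \<nu> t + 3)" by (rule power3_sum_le)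
  also have "\<dots> \<le> 3 ^ Suc (lterm_code \<nu> (Join s t))"
    using prod_encode_bounds(4)[of "lterm_code \<nu> s" "lterm_code \<nu> t"] by (intro power_increasing) simp_all
  finally show ?case .
qed

section \<open>Solving the Word Problem with the Identity Problem\<close>

definition difference_term :: "'x lterm \<Rightarrow> 'x lterm \<Rightarrow> 'x lterm" where
  "difference_term s t = Meet (Mul (Inv s) t) (Mul (Inv t) s)"

lemma lg_consequence_iff_difference_term:
  "relator_eqns R \<Turnstile>LG (s, t) \<longleftrightarrow> one_le_Sup_valid R {difference_term s t}"
proof -
  have "h s = h t \<longleftrightarrow> one_le_Sup L (h ` {difference_term s t})"
    if "lgroup L" "h \<in> lterm_hom L" for L :: "'a lterm set lgroup" and h
  proof -
    interpret lterm_interpretation L h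
      using that by (intro lterm_interpretation.intro lterm_interpretation_axioms.intro)
    have "h s = h t \<longleftrightarrow> le (h s) (h t) \<and> le (h t) (h s)"
      using le_antisym le_refl by (metis hom_simps(1))
    also have "\<dots> \<longleftrightarrow> le \<one>\<^bsub>L\<^esub> (h (difference_term s t))"
      using mult_le_left_iff[of "\<one>\<^bsub>L\<^esub>" "h t" "h s"] mult_le_left_iff[of "\<one>\<^bsub>L\<^esub>" "h s" "h t"]
      by (simp add: difference_term_def le_lmeet_iff)
    also have "\<dots> \<longleftrightarrow> one_le_Sup L (h ` {difference_term s t})"
      using one_le_big_join_iff[of "[difference_term s t]"] by simp
    finally show ?thesis .
  qed
  then show ?thesis
    unfolding lg_consequence_relator_eqns one_le_Sup_valid_def by (simp cong: imp_cong)
qed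

lemma product_term_Nil_valid_iff:
  "one_le_Sup_valid R {product_term ([], [t])} \<longleftrightarrow> one_le_Sup_valid R {t}"
proof -
  have "one_le_Sup L (h ` {product_term ([], [t])}) \<longleftrightarrow> one_le_Sup L (h ` {t})"
    if "lgroup L" "h \<in> lterm_hom L" for L :: "'a lterm set lgroup" and h
  proof -
    interpret lterm_interpretation L h
      using that by (intro lterm_interpretation.intro lterm_interpretation_axioms.intro)
    show ?thesis by simp
  qed
  then show ?thesis unfolding one_le_Sup_valid_def by (simp cong: imp_cong del: product_term.simps image_insert)
qed

lemma lgroup_word_problem_decidable_if_identity_problem_decidable:
  fixes R :: "'x word set"
  assumes R: "R \<subseteq> carrier (free_group X)" and flo: "fully_left_orderable (presented_group X R)"
    and dec: "identity_problem_decidable \<nu> X R"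
  shows "lgroup_word_problem_decidable \<nu> X R"
proof -
  define J where "J ws \<longleftrightarrow> \<one>\<^bsub>presented_group X R\<^esub> \<in>
    subsemigroup_gen (presented_group X R) (word_class X R ` set ws)" for ws
  have J: "J ws \<longleftrightarrow> one_le_Sup_valid R (word_term ` set ws)" if "ws \<noteq> []" "set ws \<subseteq> words X" for ws
    unfolding J_def identity_iff_one_le_big_join[OF R flo that] using lg_leq_big_join_iff[of "map word_term ws" R] that
    by simp
  obtain f where f: "rec1 f"
    "\<And>ws. ws \<in> lists (words X) \<Longrightarrow> f (list_encode (map (word_code \<nu>) ws)) = (if J ws then 1 else 0)"
    using dec unfolding identity_problem_decidable_def decidable_problem_iff_rec1 J_def by blast
  \<comment> \<open>On the code of a pair of terms this is the code of their
    \<open>difference_term\<close>; the tags 4, 3 and 2 are those of \<open>Meet\<close>,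
    \<open>Mul\<close> and \<open>Inv\<close>.\<close>
  define u where "u n = prod_encode (4, prod_encode (prod_encode (3, prod_encode (prod_encode (2, fstc n), sndc n)),
    prod_encode (3, prod_encode (prod_encode (2, sndc n), fstc n))))" for n
  \<comment> \<open>The initial state has a single goal with one unfinished product; each 0 codes an
    empty list or the empty word.\<close>
  define init where "init n = consc (prod_encode (0, consc (prod_encode (0, consc (u n) 0)) 0)) 0" for n
  \<comment> \<open>Comparison with 0 tests for the empty state, which means that every goal was
    accepted.\<close>
  define g where "g n = (if (stepc f ^^ (3 ^ 3 ^ (u n + 1))) (init n) = 0 then 1 else (0 :: nat))" for n
  have "rec1 g"
    unfolding g_def init_def u_def by (intro rec1_intros rec1_stepc f(1))
  moreover have "g (prod_encode (lterm_code \<nu> s, lterm_code \<nu> t)) = (if relator_eqns R \<Turnstile>LG (s, t) then 1 else 0)"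
    if "s \<in> lterms X" "t \<in> lterms X" for s t
  proof -
    let ?d = "difference_term s t" and ?n = "prod_encode (lterm_code \<nu> s, lterm_code \<nu> t)"
    let ?gs = "[([], [([], [?d])])] :: 'x goal list"
    have u: "u ?n = lterm_code \<nu> ?d" by (simp add: u_def difference_term_def)
    have init: "init ?n = state_code \<nu> ?gs"
      by (simp add: init_def u state_code_def word_code_def)
    have wf: "\<forall>g\<in>set ?gs. goal_wf X g"
      using that by (auto simp: goal_wf_def difference_term_def lterms_def)
    have "state_weight ?gs \<le> 3 ^ 3 ^ (u ?n + 1)"
      using lterm_weight_le_code[of ?d \<nu>] by (simp add: state_weight_def goal_weight_def u power_increasing)
    from machine_correct[OF J wf this]
    have "(step J ^^ (3 ^ 3 ^ (u ?n + 1))) ?gs = [] \<longleftrightarrow> relator_eqns R \<Turnstile>LG (s, t)"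
      by (simp add: state_valid_def product_term_Nil_valid_iff lg_consequence_iff_difference_term
          del: product_term.simps)
    moreover have "(stepc f ^^ k) (init ?n) = state_code \<nu> ((step J ^^ k) ?gs)" for k
      unfolding init using f(2) wf by (rule funpow_stepc_state_code)
    ultimately show ?thesis by (simp only: g_def state_code_eq_0_iff)
  qed
  ultimately show ?thesis
    unfolding lgroup_word_problem_decidable_def decidable_problem_iff_rec1 by (intro exI[of _ g]) auto
qed

section \<open>Solving the Identity Problem with the Word Problem\<close>

text \<open>Left folds, which a single pass over a coded list computes; \<open>join_words\<close> repeats its first
  joinand.\<close>

definition word_lterm :: "'x word \<Rightarrow> 'x lterm" where
  "word_lterm w = foldl (\<lambda>t a. Mul t (letter_term a)) One w"

definition join_words :: "'x word list \<Rightarrow> 'x lterm" where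
  "join_words ws = foldl (\<lambda>t w. Join t (word_lterm w)) (word_lterm (hd ws)) ws"

lemma (in lterm_interpretation) hom_word_lterm: "h (word_lterm w) = h (word_term w)"
  unfolding word_lterm_def
proof -
  have "h (foldl (\<lambda>t a. Mul t (letter_term a)) t w) = h t \<otimes> h (word_term w)" for t
    by (induction w arbitrary: t) (simp_all add: m_assoc)
  from this[of One] show "h (foldl (\<lambda>t a. Mul t (letter_term a)) One w) = h (word_term w)" by simp
qed

text \<open>Both sides have the same upper bounds, to which bracketing and the repeated joinand make
  no difference.\<close>

lemma (in lterm_interpretation) hom_join_words:
  assumes "ws \<noteq> []"
  shows "h (join_words ws) = h (big_join (map word_term ws))"
proof (rule le_cong_iff)
  fix z assume z: "z \<in> carrier L"
  have "le (h (foldl (\<lambda>t w. Join t (word_lterm w)) t ws)) z \<longleftrightarrow>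
      le (h t) z \<and> (\<forall>w\<in>set ws. le (h (word_term w)) z)" for t
    using z by (induction ws arbitrary: t) (simp_all add: ljoin_le_iff hom_word_lterm conj_assoc)
  then show "le (h (join_words ws)) z \<longleftrightarrow> le (h (big_join (map word_term ws))) z"
    using assms z big_join_le_iff[of "map word_term ws" z] by (auto simp: join_words_def hom_word_lterm)
qed simp_all

lemma lg_leq_join_words_iff:
  assumes "ws \<noteq> []"
  shows "relator_eqns R \<Turnstile>LG leq_eqn One (join_words ws) \<longleftrightarrow>
    relator_eqns R \<Turnstile>LG leq_eqn One (big_join (map word_term ws))"
proof -
  have "h (Meet One (join_words ws)) = h One \<longleftrightarrow> h (Meet One (big_join (map word_term ws))) = h One"
    if "lgroup L" "h \<in> lterm_hom L" for L :: "'a lterm set lgroup" and h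
  proof -
    interpret lterm_interpretation L h
      using that by (intro lterm_interpretation.intro lterm_interpretation_axioms.intro)
    show ?thesis using hom_join_words[OF assms] by simp
  qed
  then show ?thesis
    unfolding lg_consequence_relator_eqns leq_eqn_def by (simp cong: imp_cong)
qed

text \<open>Fusion law, used to turn a fold that builds a term into a fold that builds its
  code.\<close>

lemma map_foldl: "(\<And>a x. F (f a x) = g (F a) (k x)) \<Longrightarrow> F (foldl f a xs) = foldl g (F a) (map k xs)"
  by (induction xs arbitrary: a) simp_all

lemma identity_problem_decidable_if_lgroup_word_problem_decidable:
  fixes R :: "'x word set"
  assumes R: "R \<subseteq> carrier (free_group X)" and flo: "fully_left_orderable (presented_group X R)"
    and dec: "lgroup_word_problem_decidable \<nu> X R"
  shows "identity_problem_decidable \<nu> X R"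
proof -
  obtain f where f: "rec1 f" "\<And>s t. s \<in> lterms X \<Longrightarrow> t \<in> lterms X \<Longrightarrow>
      f (prod_encode (lterm_code \<nu> s, lterm_code \<nu> t)) = (if relator_eqns R \<Turnstile>LG (s, t) then 1 else 0)"
    using dec unfolding lgroup_word_problem_decidable_def decidable_problem_iff_rec1 by fastforce
  define letterc where "letterc a = (if sndc a = 1 then prod_encode (0, fstc a)
    else prod_encode (2, prod_encode (0, fstc a)))" for a
  \<comment> \<open>The fold starts at the code of \<open>One\<close> and appends each letter by
    \<open>Mul\<close>, whose tag is 3.\<close>
  define wordc where "wordc = foldc (\<lambda>p. prod_encode (3, prod_encode (fstc p, letterc (sndc p)))) (prod_encode (1, 0))"
  define joinc where "joinc n =
    foldc (\<lambda>p. prod_encode (5, prod_encode (fstc p, wordc (sndc p)))) (wordc (hdc n)) n" for n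
  \<comment> \<open>The code 0 is the empty list, whose subsemigroup is empty, so the answer is no.
    Otherwise the question to \<open>f\<close> is whether \<open>Meet One\<close> of the join equals
    \<open>One\<close>.\<close>
  define g where "g n = (if n = 0 then 0
    else f (prod_encode (prod_encode (4, prod_encode (prod_encode (1, 0), joinc n)), prod_encode (1, 0))))" for n
  have wordc: "rec1 (\<lambda>x. wordc (a x))" if "rec1 a" for a
    unfolding wordc_def letterc_def by (intro rec1_intros rec1_foldc that)
  have "rec1 g"
    unfolding g_def joinc_def by (intro rec1_intros rec1_comp[OF f(1)] rec1_foldc wordc)
  moreover have "g (list_encode (map (word_code \<nu>) ws)) = (if \<one>\<^bsub>presented_group X R\<^esub> \<in>
      subsemigroup_gen (presented_group X R) (word_class X R ` set ws) then 1 else 0)"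
    if ws: "ws \<in> lists (words X)" for ws
  proof (cases "ws = []")
    case True
    have "a \<notin> subsemigroup_gen (presented_group X R) {}" for a
    proof
      assume "a \<in> subsemigroup_gen (presented_group X R) {}"
      then show False by induction simp_all
    qed
    then show ?thesis using True by (simp add: g_def)
  next
    case False
    have letter: "lterm_code \<nu> (letter_term a) = letterc ((\<lambda>(x, b). prod_encode (\<nu> x, of_bool b)) a)" for a
      by (cases a) (simp add: letterc_def)
    have word: "wordc (word_code \<nu> w) = lterm_code \<nu> (word_lterm w)" for w
      unfolding wordc_def word_code_def foldc_list_encode word_lterm_def
      by (subst map_foldl[where F = "lterm_code \<nu>"]) (simp_all add: letter)
    have join: "joinc (list_encode (map (word_code \<nu>) ws)) = lterm_code \<nu> (join_words ws)"
    proof -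
      have "hdc (list_encode (map (word_code \<nu>) ws)) = word_code \<nu> (hd ws)"
        using False by (cases ws) simp_all
      then show ?thesis
        unfolding joinc_def foldc_list_encode join_words_def
        by (subst map_foldl[where F = "lterm_code \<nu>"]) (simp_all add: word)
    qed
    have wX: "word_lterm w \<in> lterms X" if "w \<in> words X" for w
    proof -
      have "foldl (\<lambda>t a. Mul t (letter_term a)) t w \<in> lterms X" if "t \<in> lterms X" for t
        using \<open>w \<in> words X\<close> that
      proof (induction w arbitrary: t)
        case (Cons a w)
        then have "Mul t (letter_term a) \<in> lterms X" by (cases a) (auto simp: lterms_def)
        then show ?case using Cons.IH by simp
      qed simp
      then show ?thesis by (simp add: word_lterm_def lterms_def)
    qed
    have "foldl (\<lambda>t w. Join t (word_lterm w)) t ws \<in> lterms X" if "t \<in> lterms X" for t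
      using ws that
    proof (induction ws arbitrary: t)
      case (Cons w ws)
      then have "Join t (word_lterm w) \<in> lterms X" using wX[of w] by (simp add: lterms_def)
      then show ?case using Cons.IH by simp
    qed simp
    moreover have "hd ws \<in> words X" using ws False by (cases ws) auto
    ultimately have jX: "join_words ws \<in> lterms X" using wX by (simp add: join_words_def)
    have "list_encode (map (word_code \<nu>) ws) \<noteq> 0" using False by (cases ws) simp_all
    then have "g (list_encode (map (word_code \<nu>) ws)) =
        f (prod_encode (lterm_code \<nu> (Meet One (join_words ws)), lterm_code \<nu> One))"
      by (simp add: g_def join)
    also have "\<dots> = (if relator_eqns R \<Turnstile>LG leq_eqn One (join_words ws) then 1 else 0)"
      unfolding leq_eqn_def using jX by (intro f(2)) (simp_all add: lterms_def)
    finally show ?thesis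
      using lg_leq_join_words_iff[OF False, of R] identity_iff_one_le_big_join[OF R flo False] ws by auto
  qed
  ultimately show ?thesis
    unfolding identity_problem_decidable_def decidable_problem_iff_rec1 by blast
qed

theorem corollary10:
  fixes X :: "'x set" and R :: "'x word set"
  assumes "R \<subseteq> carrier (free_group X)"
    and "fully_left_orderable (presented_group X R)"
  shows "(\<forall>ts. ts \<noteq> [] \<and> set ts \<subseteq> carrier (free_group X) \<longrightarrow>
            (\<one>\<^bsub>presented_group X R\<^esub> \<in>
               subsemigroup_gen (presented_group X R) (word_class X R ` set ts)
             \<longleftrightarrow> relator_eqns R \<Turnstile>LG leq_eqn One (big_join (map word_term ts)))) \<and>
         (\<forall>\<nu> :: 'x \<Rightarrow> nat. inj_on \<nu> X \<longrightarrow>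
            (identity_problem_decidable \<nu> X R \<longleftrightarrow> lgroup_word_problem_decidable \<nu> X R))"
proof (intro conjI allI impI)
  fix ts :: "'x word list" assume "ts \<noteq> [] \<and> set ts \<subseteq> carrier (free_group X)"
  then show "\<one>\<^bsub>presented_group X R\<^esub> \<in>
      subsemigroup_gen (presented_group X R) (word_class X R ` set ts)
    \<longleftrightarrow> relator_eqns R \<Turnstile>LG leq_eqn One (big_join (map word_term ts))"
    by (intro identity_iff_one_le_big_join[OF assms]) (auto simp: free_group_def)
next
  fix \<nu> :: "'x \<Rightarrow> nat"
  show "identity_problem_decidable \<nu> X R \<longleftrightarrow> lgroup_word_problem_decidable \<nu> X R"
    using lgroup_word_problem_decidable_if_identity_problem_decidable[OF assms]
      identity_problem_decidable_if_lgroup_word_problem_decidable[OF assms] by blast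
qed

end
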